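(* Let $\kappa$ be a cardinal number and assume Martin's axiom for $\kappa$, $\mathrm{MA}(\kappa)$. Let $K$ be a separable scattered compact space of height $3$ and weight $\kappa$. Then every twisted sum of $c_0$ and $C(K)$ is trivial.
   Context: Compact spaces are Hausdorff. A space $X$ is scattered if no nonempty subset of $X$ is dense-in-itself. $X^{(\alpha)}$ denotes the $\alpha$th Cantor–Bendixson derivative of $X$, and the height of a scattered space $X$ is $\min\{\alpha: X^{(\alpha)}=\emptyset\}$. $C(K)$ is the Banach space of continuous real-valued functions on $K$. A twisted sum of Banach spaces $Z$ and $Y$ is a short exact sequence $0\to Z\to X\to Y\to 0$ with $X$ a Banach space and the maps bounded linear operators; it is trivial if it splits, i.e. the map $Z\to X$ has a bounded linear left inverse (equivalently, the range of $Z\to X$ is complemented in $X$). $\mathrm{MA}(\kappa)$: for every nonempty partially ordered set $(\mathbb P,\le)$ satisfying ccc (every uncountable subset of $\mathbb P$ contains two distinct elements $p_1,p_2$ having a common upper bound $q\in\mathbb P$, $p_1,p_2\le q$) and every family $\{\mathbb D_\xi:\xi<\kappa\}$ of dense subsets of $\mathbb P$ (for every $p\in \mathbb P$ there is $d\in \mathbb D_\xi$ with $p\le d$), there is a directed set $\mathbb G\subseteq\mathbb P$ (any $p_1,p_2\in\mathbb G$ have an upper bound in $\mathbb G$) with $\mathbb G\cap\mathbb D_\xi\neq\emptyset$ for every $\xi<\kappa$. ($\mathrm{MA}(\kappa)$ can hold only for $\kappa<\mathfrak c$.) *)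

theory Defs
  imports "HOL-Analysis.Analysis"
begin

unbundle cardinal_syntax

section \<open>Topology\<close>

definition scattered :: "'a::topological_space set \<Rightarrow> bool" where
  "scattered X \<longleftrightarrow> \<not> (\<exists>A\<subseteq>X. A \<noteq> {} \<and> (\<forall>x\<in>A. x islimpt A))"

fun cb_derivative :: "'a::topological_space set \<Rightarrow> nat \<Rightarrow> 'a set" where
  "cb_derivative X 0 = X"
| "cb_derivative X (Suc n) = {x \<in> cb_derivative X n. x islimpt cb_derivative X n}"

text \<open>The least ordinal \<open>\<alpha>\<close> with empty \<open>\<alpha>\<close>-th derivative is the finite ordinal \<open>n\<close>. Ordinals
  below \<open>n\<close> are finite, so no transfinite derivatives are involved.\<close>

definition has_cb_height :: "'a::topological_space set \<Rightarrow> nat \<Rightarrow> bool" where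
  "has_cb_height X n \<longleftrightarrow> cb_derivative X n = {} \<and> (\<forall>m<n. cb_derivative X m \<noteq> {})"

text \<open>The weight of the space \<open>'a\<close> (the least cardinality of a base) is the cardinal \<open>\<kappa>\<close>, where
  cardinals are represented by cardinal orders.\<close>

definition has_weight :: "'a::topological_space itself \<Rightarrow> 'c rel \<Rightarrow> bool" where
  "has_weight _ \<kappa> \<longleftrightarrow>
     (\<exists>B::'a set set. topological_basis B \<and> ( |B|, \<kappa>) \<in> ordIso) \<and>
     (\<forall>B::'a set set. topological_basis B \<longrightarrow> \<kappa> \<le>o |B| )"


section \<open>Martin's axiom\<close>

text \<open>A poset is given by a carrier \<open>P\<close> and a relation \<open>le\<close>; \<open>(p, q) \<in> le\<close> means \<open>p \<le> q\<close>, and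
  stronger conditions are larger.\<close>

definition ccc_poset :: "'p set \<Rightarrow> 'p rel \<Rightarrow> bool" where
  "ccc_poset P le \<longleftrightarrow>
     (\<forall>A\<subseteq>P. uncountable A \<longrightarrow>
        (\<exists>p\<in>A. \<exists>p'\<in>A. p \<noteq> p' \<and> (\<exists>q\<in>P. (p, q) \<in> le \<and> (p', q) \<in> le)))"

definition dense_in_poset :: "'p set \<Rightarrow> 'p rel \<Rightarrow> 'p set \<Rightarrow> bool" where
  "dense_in_poset P le D \<longleftrightarrow> D \<subseteq> P \<and> (\<forall>p\<in>P. \<exists>d\<in>D. (p, d) \<in> le)"

definition directed_in_poset :: "'p rel \<Rightarrow> 'p set \<Rightarrow> bool" where
  "directed_in_poset le G \<longleftrightarrow> (\<forall>p\<in>G. \<forall>p'\<in>G. \<exists>q\<in>G. (p, q) \<in> le \<and> (p', q) \<in> le)"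

text \<open>Martin's axiom for \<open>\<kappa>\<close> and for all posets whose elements come from the type \<open>'p\<close>.\<close>

definition martins_axiom_on :: "'p itself \<Rightarrow> 'c rel \<Rightarrow> bool" where
  "martins_axiom_on _ \<kappa> \<longleftrightarrow>
     (\<forall>(P::'p set) le D.
        P \<noteq> {} \<and> partial_order_on P le \<and> ccc_poset P le \<and>
        (\<forall>\<xi>\<in>Field \<kappa>. dense_in_poset P le (D \<xi>)) \<longrightarrow>
        (\<exists>G\<subseteq>P. directed_in_poset le G \<and> (\<forall>\<xi>\<in>Field \<kappa>. G \<inter> D \<xi> \<noteq> {})))"

text \<open>A HOL formula cannot quantify over the types \<open>'p\<close>. The instance below, with a type that has
  room for every poset of cardinality at most \<open>\<kappa> + \<omega>\<close>, implies all the others: this is lemma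
  \<open>martins_axiom_imp_on\<close>, in which \<open>'q\<close> is an arbitrary type.\<close>

definition martins_axiom :: "'c rel \<Rightarrow> bool" where
  "martins_axiom \<kappa> \<longleftrightarrow> martins_axiom_on TYPE('c + nat) \<kappa>"

text \<open>Lowenheim-Skolem: close a point of the poset under witnesses of density and of
  compatibility.\<close>

lemma small_closure:
  fixes \<kappa> :: "'c rel" and f :: "'c \<Rightarrow> 'q \<Rightarrow> 'q" and g :: "'q \<Rightarrow> 'q \<Rightarrow> 'q" and P :: "'q set"
  assumes "p0 \<in> P" and f: "\<And>\<xi> p. \<xi> \<in> Field \<kappa> \<Longrightarrow> p \<in> P \<Longrightarrow> f \<xi> p \<in> P"
    and g: "\<And>p p'. p \<in> P \<Longrightarrow> p' \<in> P \<Longrightarrow> g p p' \<in> P"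
  obtains Q where "Q \<subseteq> P" "p0 \<in> Q" "|Q| \<le>o |UNIV :: ('c + nat) set|"
    "\<And>\<xi> p. \<xi> \<in> Field \<kappa> \<Longrightarrow> p \<in> Q \<Longrightarrow> f \<xi> p \<in> Q" "\<And>p p'. p \<in> Q \<Longrightarrow> p' \<in> Q \<Longrightarrow> g p p' \<in> Q"
proof -
  let ?U = "UNIV :: ('c + nat) set"
  define step where "step A = A \<union> (\<lambda>(\<xi>, p). f \<xi> p) ` (Field \<kappa> \<times> A) \<union> (\<lambda>(p, p'). g p p') ` (A \<times> A)" for A
  define S where "S n = (step ^^ n) {p0}" for n
  have S_Suc: "S (Suc n) = step (S n)" for n by (simp add: S_def)
  have inf: "\<not> finite ?U" by simp
  have inf': "\<not> finite (Field |?U| )" by (simp add: Field_card_of)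
  have co: "Card_order |?U|" by (rule card_of_Card_order)
  have nat_le: "|UNIV::nat set| \<le>o |?U|"
    by (rule card_of_ordLeq[THEN iffD1], rule exI[of _ Inr]) auto
  have c_le: "|Field \<kappa>| \<le>o |?U|"
    by (rule card_of_ordLeq[THEN iffD1], rule exI[of _ Inl]) auto
  have S_le: "|S n| \<le>o |?U|" for n
  proof (induction n)
    case 0
    then show ?case by (simp add: S_def card_of_singl_ordLeq)
  next
    case (Suc n)
    have 1: "|(\<lambda>(\<xi>, p). f \<xi> p) ` (Field \<kappa> \<times> S n)| \<le>o |?U|"
      by (rule ordLeq_transitive[OF card_of_image card_of_Times_ordLeq_infinite_Field[OF inf' c_le Suc co]])
    have 2: "|(\<lambda>(p, p'). g p p') ` (S n \<times> S n)| \<le>o |?U|"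
      by (rule ordLeq_transitive[OF card_of_image card_of_Times_ordLeq_infinite_Field[OF inf' Suc Suc co]])
    show ?case unfolding S_Suc step_def
      by (intro card_of_Un_ordLeq_infinite_Field inf' co Suc 1 2)
  qed
  have S_P: "S n \<subseteq> P" for n
  proof (induction n)
    case 0
    then show ?case using assms(1) by (simp add: S_def)
  next
    case (Suc n)
    show ?case
    proof
      fix x assume "x \<in> S (Suc n)"
      then consider "x \<in> S n" | \<xi> p where "\<xi> \<in> Field \<kappa>" "p \<in> S n" "x = f \<xi> p"
        | p p' where "p \<in> S n" "p' \<in> S n" "x = g p p'"
        unfolding S_Suc step_def by auto
      then show "x \<in> P" using Suc f g by cases blast+
    qed
  qed
  have mono: "S m \<subseteq> S n" if "m \<le> n" for m n
    using that by (rule lift_Suc_mono_le[rotated]) (auto simp: S_Suc step_def)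
  show ?thesis
  proof (rule that[of "\<Union>n. S n"])
    show "(\<Union>n. S n) \<subseteq> P" using S_P by blast
    have "p0 \<in> S 0" by (simp add: S_def)
    then show "p0 \<in> (\<Union>n. S n)" by blast
    show "|\<Union>n. S n| \<le>o |?U|"
      using S_le by (intro card_of_UNION_ordLeq_infinite inf nat_le) auto
  next
    fix \<xi> p assume "\<xi> \<in> Field \<kappa>" "p \<in> (\<Union>n. S n)"
    then obtain n where "p \<in> S n" by blast
    then have "f \<xi> p \<in> S (Suc n)" using \<open>\<xi> \<in> Field \<kappa>\<close> by (auto simp: S_Suc step_def)
    then show "f \<xi> p \<in> (\<Union>n. S n)" by blast
  next
    fix p p' assume "p \<in> (\<Union>n. S n)" "p' \<in> (\<Union>n. S n)"
    then obtain m n where "p \<in> S m" "p' \<in> S n" by blast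
    then have "p \<in> S (max m n)" "p' \<in> S (max m n)" using mono by (meson max.cobounded1 max.cobounded2 subsetD)+
    then have "g p p' \<in> S (Suc (max m n))" by (auto simp: S_Suc step_def)
    then show "g p p' \<in> (\<Union>n. S n)" by blast
  qed
qed

lemma martins_axiom_imp_on:
  fixes \<kappa> :: "'c rel"
  assumes ma: "martins_axiom \<kappa>"
  shows "martins_axiom_on TYPE('q) \<kappa>"
  unfolding martins_axiom_on_def
proof (intro allI impI, elim conjE)
  fix P :: "'q set" and le :: "'q rel" and D :: "'c \<Rightarrow> 'q set"
  assume ne: "P \<noteq> {}" and po: "partial_order_on P le" and ccc: "ccc_poset P le"
    and dense: "\<forall>\<xi>\<in>Field \<kappa>. dense_in_poset P le (D \<xi>)"
  obtain p0 where p0: "p0 \<in> P" using ne by blast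
  define f where "f \<xi> p = (SOME d. d \<in> D \<xi> \<and> (p, d) \<in> le)" for \<xi> p
  have f: "f \<xi> p \<in> D \<xi> \<and> (p, f \<xi> p) \<in> le" if "\<xi> \<in> Field \<kappa>" "p \<in> P" for \<xi> p
  proof -
    have "\<exists>d. d \<in> D \<xi> \<and> (p, d) \<in> le" using dense that unfolding dense_in_poset_def by blast
    then show ?thesis unfolding f_def by (rule someI_ex)
  qed
  have DP: "D \<xi> \<subseteq> P" if "\<xi> \<in> Field \<kappa>" for \<xi>
    using dense that by (auto simp: dense_in_poset_def)
  define cmp where "cmp p p' q \<longleftrightarrow> q \<in> P \<and> (p, q) \<in> le \<and> (p', q) \<in> le" for p p' q
  define g where "g p p' = (if Ex (cmp p p') then Eps (cmp p p') else p0)" for p p'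
  have g: "cmp p p' (g p p')" if "cmp p p' q" for p p' q
  proof -
    have ex: "Ex (cmp p p')" using that by blast
    then show ?thesis using someI_ex[OF ex] by (simp add: g_def)
  qed
  have gP: "g p p' \<in> P" for p p'
  proof (cases "Ex (cmp p p')")
    case True
    then show ?thesis using g cmp_def by blast
  next
    case False
    then have "g p p' = p0" unfolding g_def by (rule if_not_P)
    then show ?thesis using p0 by simp
  qed
  obtain Q where Q: "Q \<subseteq> P" "p0 \<in> Q" "|Q| \<le>o |UNIV :: ('c + nat) set|"
    and fQ: "\<And>\<xi> p. \<xi> \<in> Field \<kappa> \<Longrightarrow> p \<in> Q \<Longrightarrow> f \<xi> p \<in> Q"
    and gQ: "\<And>p p'. p \<in> Q \<Longrightarrow> p' \<in> Q \<Longrightarrow> g p p' \<in> Q"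
  proof (rule small_closure[of p0 P \<kappa> f g])
    show "f \<xi> p \<in> P" if "\<xi> \<in> Field \<kappa>" "p \<in> P" for \<xi> p using f DP that by blast
  qed (use p0 gP in auto)
  obtain h :: "'q \<Rightarrow> 'c + nat" where h: "inj_on h Q"
    using Q(3) by (auto simp flip: card_of_ordLeq)
  have h_eq: "h x = h y \<longleftrightarrow> x = y" if "x \<in> Q" "y \<in> Q" for x y
    using h that by (auto dest: inj_onD)
  define le' where "le' = {(h x, h y) | x y. x \<in> Q \<and> y \<in> Q \<and> (x, y) \<in> le}"
  have le'_iff: "(h x, h y) \<in> le' \<longleftrightarrow> (x, y) \<in> le" if "x \<in> Q" "y \<in> Q" for x y
    using that h_eq unfolding le'_def by blast
  have le_refl: "(x, x) \<in> le" if "x \<in> P" for x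
    using po that by (auto simp: partial_order_on_def preorder_on_def refl_on_def)
  have tr: "trans le" and as: "antisym le"
    using po by (auto simp: partial_order_on_def preorder_on_def)
  have 1: "partial_order_on (h ` Q) le'"
    unfolding partial_order_on_def preorder_on_def
  proof (intro conjI)
    show "le' \<subseteq> h ` Q \<times> h ` Q" by (auto simp: le'_def)
    show "refl_on (h ` Q) le'" using le_refl Q(1) by (auto simp: refl_on_def le'_iff)
    show "trans le'"
    proof (rule transI)
      fix a b c assume "(a, b) \<in> le'" "(b, c) \<in> le'"
      then obtain x y y' z where "a = h x" "b = h y" "b = h y'" "c = h z"
        "x \<in> Q" "y \<in> Q" "y' \<in> Q" "z \<in> Q" "(x, y) \<in> le" "(y', z) \<in> le"
        unfolding le'_def by blast
      then show "(a, c) \<in> le'" using h_eq le'_iff tr by (metis transD)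
    qed
    show "antisym le'"
    proof (rule antisymI)
      fix a b assume "(a, b) \<in> le'" "(b, a) \<in> le'"
      then obtain x y where "a = h x" "b = h y" "x \<in> Q" "y \<in> Q" "(x, y) \<in> le"
        unfolding le'_def by blast
      then show "a = b" using \<open>(b, a) \<in> le'\<close> le'_iff as by (metis antisymD)
    qed
  qed
  have 2: "ccc_poset (h ` Q) le'"
    unfolding ccc_poset_def
  proof (intro allI impI)
    fix A assume "A \<subseteq> h ` Q" "uncountable A"
    then obtain B where B: "B \<subseteq> Q" "A = h ` B" by (meson subset_imageE)
    then have "uncountable B" using \<open>uncountable A\<close> by blast
    then obtain p p' q where pq: "p \<in> B" "p' \<in> B" "p \<noteq> p'" "cmp p p' q"
      using ccc B Q(1) unfolding ccc_poset_def cmp_def by (meson order_trans)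
    then have "cmp p p' (g p p')" "g p p' \<in> Q" "p \<in> Q" "p' \<in> Q" using g gQ B by blast+
    then have "h p \<in> A \<and> h p' \<in> A \<and> h p \<noteq> h p' \<and> h (g p p') \<in> h ` Q \<and>
        (h p, h (g p p')) \<in> le' \<and> (h p', h (g p p')) \<in> le'"
      using pq B by (auto simp: le'_iff h_eq cmp_def)
    then show "\<exists>p\<in>A. \<exists>p'\<in>A. p \<noteq> p' \<and> (\<exists>q\<in>h ` Q. (p, q) \<in> le' \<and> (p', q) \<in> le')" by blast
  qed
  have 3: "dense_in_poset (h ` Q) le' (h ` (D \<xi> \<inter> Q))" if "\<xi> \<in> Field \<kappa>" for \<xi>
    unfolding dense_in_poset_def
  proof (intro conjI ballI)
    fix a assume "a \<in> h ` Q"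
    then obtain p where p: "p \<in> Q" "a = h p" by blast
    then show "\<exists>d\<in>h ` (D \<xi> \<inter> Q). (a, d) \<in> le'"
      using f[OF that] fQ[OF that] Q(1) le'_iff by (intro bexI[of _ "h (f \<xi> p)"]) auto
  qed auto
  have "\<exists>G\<subseteq>h ` Q. directed_in_poset le' G \<and> (\<forall>\<xi>\<in>Field \<kappa>. G \<inter> h ` (D \<xi> \<inter> Q) \<noteq> {})"
    using ma[unfolded martins_axiom_def martins_axiom_on_def, rule_format,
        of "h ` Q" le' "\<lambda>\<xi>. h ` (D \<xi> \<inter> Q)"] 1 2 3 Q(2) by blast
  then obtain G' where G': "G' \<subseteq> h ` Q" "directed_in_poset le' G'"
    "\<forall>\<xi>\<in>Field \<kappa>. G' \<inter> h ` (D \<xi> \<inter> Q) \<noteq> {}" by blast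
  then obtain G where G: "G \<subseteq> Q" "G' = h ` G" by (meson subset_imageE)
  show "\<exists>G\<subseteq>P. directed_in_poset le G \<and> (\<forall>\<xi>\<in>Field \<kappa>. G \<inter> D \<xi> \<noteq> {})"
  proof (intro exI[of _ G] conjI ballI)
    show "G \<subseteq> P" using G Q by blast
    show "directed_in_poset le G"
      unfolding directed_in_poset_def
    proof (intro ballI)
      fix p p' assume p: "p \<in> G" "p' \<in> G"
      then obtain q where "q \<in> G" "(h p, h q) \<in> le'" "(h p', h q) \<in> le'"
        using G'(2) unfolding directed_in_poset_def G(2) by blast
      then show "\<exists>q\<in>G. (p, q) \<in> le \<and> (p', q) \<in> le"
        using p G(1) le'_iff by (meson subsetD)
    qed
    fix \<xi> assume "\<xi> \<in> Field \<kappa>"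
    then obtain x y where "x \<in> G" "y \<in> D \<xi> \<inter> Q" "h x = h y" using G'(3) G(2) by blast
    then show "G \<inter> D \<xi> \<noteq> {}" using h_eq G(1) by blast
  qed
qed


section \<open>Banach spaces\<close>

text \<open>The library proves completeness of the space of bounded continuous functions only over metric
  spaces, whereas compact spaces here need not be metrizable.\<close>

instance bcontfun :: (topological_space, complete_space) complete_space
proof
  fix f :: "nat \<Rightarrow> ('a, 'b) bcontfun"
  assume "Cauchy f"
  then obtain g where "uniform_limit UNIV f g sequentially"
    using uniformly_convergent_eq_cauchy[of "\<lambda>_. True" f]
    unfolding Cauchy_def uniform_limit_sequentially_iff
    by (metis dist_fun_lt_imp_dist_val_lt)
  from uniform_limit_bcontfunE[OF this sequentially_bot]
  obtain l' where "g = apply_bcontfun l'" "(f \<longlonglongrightarrow> l')" by metis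
  then show "convergent f"
    by (intro convergentI)
qed

instance bcontfun :: (topological_space, banach) banach ..

text \<open>The space of null sequences, with the supremum norm inherited from the bounded sequences
  (= bounded continuous functions on the discrete space of natural numbers).\<close>

typedef c0 = "{f :: nat \<Rightarrow>\<^sub>C real. (\<lambda>n. apply_bcontfun f n) \<longlonglongrightarrow> 0}"
  morphisms c0_seq Abs_c0
  by (rule exI[of _ 0]) simp

lemma c0_seq_tendsto: "(\<lambda>n. apply_bcontfun (c0_seq x) n) \<longlonglongrightarrow> 0"
  using c0_seq[of x] by simp

lemma c0_eqI: "c0_seq x = c0_seq y \<Longrightarrow> x = y"
  by (simp add: c0_seq_inject)

instantiation c0 :: real_vector
begin

definition "0 = Abs_c0 0"
definition "x + y = Abs_c0 (c0_seq x + c0_seq y)"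
definition "- x = Abs_c0 (- c0_seq x)"
definition "x - y = Abs_c0 (c0_seq x - c0_seq y)" for x y :: c0
definition "a *\<^sub>R x = Abs_c0 (a *\<^sub>R c0_seq x)"

lemma c0_seq_0: "c0_seq 0 = 0"
  unfolding zero_c0_def by (rule Abs_c0_inverse) simp

lemma c0_seq_add: "c0_seq (x + y) = c0_seq x + c0_seq y"
  unfolding plus_c0_def
  using tendsto_add[OF c0_seq_tendsto[of x] c0_seq_tendsto[of y]] by (intro Abs_c0_inverse) simp

lemma c0_seq_minus: "c0_seq (- x) = - c0_seq x"
  unfolding uminus_c0_def
  using tendsto_minus[OF c0_seq_tendsto[of x]] by (intro Abs_c0_inverse) simp

lemma c0_seq_diff: "c0_seq (x - y) = c0_seq x - c0_seq y"
  unfolding minus_c0_def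
  using tendsto_diff[OF c0_seq_tendsto[of x] c0_seq_tendsto[of y]] by (intro Abs_c0_inverse) simp

lemma c0_seq_scaleR: "c0_seq (a *\<^sub>R x) = a *\<^sub>R c0_seq x"
  unfolding scaleR_c0_def
  using tendsto_mult_right_zero[OF c0_seq_tendsto[of x], of a] by (intro Abs_c0_inverse) simp

lemmas c0_seq_simps = c0_seq_0 c0_seq_add c0_seq_minus c0_seq_diff c0_seq_scaleR

instance
  by standard (auto intro!: c0_eqI simp: c0_seq_simps algebra_simps)

end

instantiation c0 :: real_normed_vector
begin

definition "norm x = norm (c0_seq x)"
definition "dist x y = dist (c0_seq x) (c0_seq y)"
definition "sgn x = x /\<^sub>R norm x" for x :: c0
definition uniformity_c0 :: "(c0 \<times> c0) filter"
  where "uniformity_c0 = (INF e\<in>{0<..}. principal {(x, y). dist x y < e})"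
definition open_c0 :: "c0 set \<Rightarrow> bool"
  where "open_c0 U \<longleftrightarrow> (\<forall>x\<in>U. \<forall>\<^sub>F (x', y) in uniformity. x' = x \<longrightarrow> y \<in> U)"

instance
proof
  fix x y :: c0 and a :: real
  show "dist x y = norm (x - y)"
    by (simp add: dist_c0_def norm_c0_def c0_seq_simps dist_norm)
  show "(norm x = 0) = (x = 0)"
    by (metis c0_eqI c0_seq_0 norm_c0_def norm_eq_zero)
  show "norm (x + y) \<le> norm x + norm y"
    by (simp add: norm_c0_def c0_seq_simps norm_triangle_ineq)
  show "norm (a *\<^sub>R x) = \<bar>a\<bar> * norm x"
    by (simp add: norm_c0_def c0_seq_simps)
qed (simp_all add: sgn_c0_def uniformity_c0_def open_c0_def)

end

instance c0 :: banach
proof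
  fix X :: "nat \<Rightarrow> c0"
  assume "Cauchy X"
  then have "Cauchy (\<lambda>n. c0_seq (X n))"
    by (simp add: Cauchy_def dist_c0_def)
  then obtain f where f: "(\<lambda>n. c0_seq (X n)) \<longlonglongrightarrow> f"
    using Cauchy_convergent convergent_def by blast
  have "apply_bcontfun f \<longlonglongrightarrow> 0"
  proof (rule LIMSEQ_I)
    fix r :: real assume "0 < r"
    then obtain n where n: "dist (c0_seq (X n)) f < r / 2"
      using f by (metis half_gt_zero le_refl lim_sequentially)
    obtain N where N: "\<And>k. k \<ge> N \<Longrightarrow> norm (c0_seq (X n) k - 0) < r / 2"
      using LIMSEQ_D[OF c0_seq_tendsto[of "X n"], of "r / 2"] \<open>0 < r\<close> by auto
    show "\<exists>N. \<forall>k\<ge>N. norm (f k - 0) < r"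
    proof (intro exI allI impI)
      fix k assume "k \<ge> N"
      have "dist (c0_seq (X n) k) (f k) < r / 2"
        using n dist_bounded[of "c0_seq (X n)" k f] by simp
      moreover have "\<bar>c0_seq (X n) k\<bar> < r / 2" using N[OF \<open>k \<ge> N\<close>] by simp
      ultimately have "\<bar>f k\<bar> < r" unfolding dist_real_def by linarith
      then show "norm (f k - 0) < r" by simp
    qed
  qed
  then have "c0_seq (Abs_c0 f) = f" by (simp add: Abs_c0_inverse)
  then have "X \<longlonglongrightarrow> Abs_c0 f"
    using f by (simp add: lim_sequentially dist_c0_def)
  then show "convergent X" by (rule convergentI)
qed

text \<open>A short exact sequence \<open>0 \<rightarrow> Z \<rightarrow> X \<rightarrow> Y \<rightarrow> 0\<close> with maps \<open>i\<close>, \<open>q\<close>.\<close>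

definition twisted_sum :: "('z::banach \<Rightarrow> 'x::banach) \<Rightarrow> ('x \<Rightarrow> 'y::banach) \<Rightarrow> bool" where
  "twisted_sum i q \<longleftrightarrow>
     bounded_linear i \<and> bounded_linear q \<and> inj i \<and> range i = {x. q x = 0} \<and> surj q"

definition trivial_twisted_sum :: "('z::banach \<Rightarrow> 'x::banach) \<Rightarrow> ('x \<Rightarrow> 'y::banach) \<Rightarrow> bool" where
  "trivial_twisted_sum i q \<longleftrightarrow>
     twisted_sum i q \<and> (\<exists>r. bounded_linear r \<and> (\<forall>z. r (i z) = z))"

end

theory Submission
  imports Defs
begin

text \<open>
Let \<open>f n\<close> be uniformly bounded extensions to \<open>X\<close> of the coordinate functionals of \<open>c0\<close>. They exist
by the open mapping theorem and the Hahn-Banach theorem (\<open>coordinate_extensions\<close>). A bounded left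
inverse of \<open>i\<close> is obtained from any bounded sequence \<open>m n\<close> in the dual of \<open>C(K)\<close> for which
\<open>f n x - m n (q x)\<close> tends to 0 for every \<open>x\<close>: the functionals \<open>f n - m n \<circ> q\<close> are then the
coordinates of an operator into \<open>c0\<close>, and they still extend the coordinate functionals since
\<open>q \<circ> i = 0\<close>. It suffices to check the convergence for \<open>q x\<close> in a set with dense span
(\<open>null_everywhere\<close>).

A separable compact space \<open>K\<close> of height 3 has countably many isolated points. Its first derivative
\<open>K1\<close> carries relatively isolated points \<open>\<xi>\<close>, each of them cut out of \<open>K1\<close> by a clopen set \<open>U \<xi>\<close>,
and its second derivative \<open>K2\<close> is finite. The indicators of isolated points, the indicators of the
\<open>U \<xi>\<close> and a finite family biorthogonal to the points of \<open>K2\<close> have dense span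
(\<open>dense_span_generators\<close>). The measures \<open>m n\<close> are built as a sum of three parts, one for each kind
of generator:

\<^item> a measure on the first \<open>J n\<close> isolated points, where \<open>J n\<close> tends to infinity slowly enough to
  keep the norms bounded (\<open>isolated_point_correction\<close>);

\<^item> measures supported by finite sets of isolated points that run off to infinity and have given
  masses on the sets \<open>U \<xi>\<close> (\<open>martin_correction\<close>);

\<^item> a combination of the point masses of \<open>K2\<close> (\<open>finite_correction\<close>).

The second part is the heart of the matter. After the first step the functionals are null on
isolated points, so in the limit they act on \<open>C(K)\<close> modulo those, and their values \<open>h \<xi> n\<close> on the
indicators of the \<open>U \<xi>\<close> satisfy \<open>\<Sum>\<xi>\<in>F. \<bar>h \<xi> n\<bar> \<le> C\<close> for every finite \<open>F\<close> and all large \<open>n\<close>. Since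
the traces of the \<open>U \<xi>\<close> on the isolated points are almost disjoint, finitely many masses can be
prescribed at cost \<open>C\<close>. To do so for all \<open>\<xi>\<close> simultaneously, \<open>martins_axiom_masses\<close> forces with
finite approximations; allowing cost \<open>2 * C\<close> makes any two conditions with the same finite
sequence of measures compatible, and there are only countably many such sequences.
\<close>

section \<open>The Hahn-Banach and open mapping theorems\<close>

definition sublinear :: "('v::real_vector \<Rightarrow> real) \<Rightarrow> bool" where
  "sublinear p \<longleftrightarrow> (\<forall>x y. p (x + y) \<le> p x + p y) \<and> (\<forall>t\<ge>0. \<forall>x. p (t *\<^sub>R x) = t * p x)"

lemma sublinearD:
  assumes "sublinear p"
  shows sublinear_add: "p (x + y) \<le> p x + p y"
    and sublinear_scale: "0 \<le> t \<Longrightarrow> p (t *\<^sub>R x) = t * p x"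
    and sublinear_zero: "p 0 = 0"
    and sublinear_lower: "- p (- x) \<le> p x"
proof -
  show a: "p (x + y) \<le> p x + p y" for x y using assms by (simp add: sublinear_def)
  show "0 \<le> t \<Longrightarrow> p (t *\<^sub>R x) = t * p x" using assms by (simp add: sublinear_def)
  show z: "p 0 = 0" using assms unfolding sublinear_def
    by (metis mult_zero_left order_refl scaleR_zero_left)
  show "- p (- x) \<le> p x" using a[of x "-x"] z by simp
qed

text \<open>Lowering a sublinear functional as far as prescribed values allow: passing to the infimum of
  \<open>p (x + v) - a\<close> over a convex cone of pairs \<open>(v, a)\<close> with \<open>a \<le> p v\<close> keeps sublinearity and
  forces \<open>p' (- v) \<le> - a\<close>. The cone spanned by a single pair \<open>(y, p y)\<close> shows below that minimal
  sublinear functionals are additive, and the graph of a linear functional gives the extension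
  property.\<close>

lemma sublinear_improve:
  fixes p :: "'v::real_vector \<Rightarrow> real" and C :: "('v \<times> real) set"
  assumes p: "sublinear p"
    and zero: "(0, 0) \<in> C"
    and add: "\<And>v a w b. (v, a) \<in> C \<Longrightarrow> (w, b) \<in> C \<Longrightarrow> (v + w, a + b) \<in> C"
    and scale: "\<And>t v a. 0 \<le> t \<Longrightarrow> (v, a) \<in> C \<Longrightarrow> (t *\<^sub>R v, t * a) \<in> C"
    and dom: "\<And>v a. (v, a) \<in> C \<Longrightarrow> a \<le> p v"
  obtains p' where "sublinear p'" "\<And>x. p' x \<le> p x" "\<And>x v a. (v, a) \<in> C \<Longrightarrow> p' x \<le> p (x + v) - a"
proof -
  define g where "g x = (\<lambda>(v, a). p (x + v) - a)" for x
  define p' where "p' x = (INF c\<in>C. g x c)" for x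
  \<comment> \<open>The infimum is finite since \<open>a \<le> p v \<le> p (x + v) + p (- x)\<close>.\<close>
  have low: "- p (- x) \<le> g x c" if "c \<in> C" for x c
  proof -
    obtain v a where c: "c = (v, a)" by fastforce
    have "p v \<le> p (x + v) + p (- x)" using sublinear_add[OF p, of "x + v" "- x"] by simp
    then show ?thesis using dom that by (fastforce simp: g_def c)
  qed
  have bdd: "bdd_below (g x ` C)" for x using low by (auto intro!: bdd_belowI2)
  have up: "p' x \<le> p (x + v) - a" if "(v, a) \<in> C" for x v a
    using cINF_lower[OF bdd that, of x] by (simp add: p'_def g_def)
  have near: "\<exists>v a. (v, a) \<in> C \<and> p (x + v) - a < p' x + e" if "e > 0" for x e
  proof (rule ccontr)
    assume "\<not> ?thesis"
    then have "p' x + e \<le> g x c" if "c \<in> C" for c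
      using that by (cases c) (auto simp: g_def not_less)
    then have "p' x + e \<le> p' x" unfolding p'_def using zero by (intro cINF_greatest) auto
    then show False using that by simp
  qed
  have sc: "p' (t *\<^sub>R x) \<le> t * p' x" if t: "0 < t" for t x
  proof (rule field_le_epsilon)
    fix e :: real assume "e > 0"
    then obtain v a where va: "(v, a) \<in> C" "p (x + v) - a < p' x + e / t"
      using near[of "e / t" x] t by auto
    have "p' (t *\<^sub>R x) \<le> p (t *\<^sub>R x + t *\<^sub>R v) - t * a" by (rule up) (use scale va t in auto)
    also have "\<dots> = t * (p (x + v) - a)"
      using sublinear_scale[OF p, of t "x + v"] t by (simp add: algebra_simps)
    also have "\<dots> \<le> t * (p' x + e / t)" using va t by (intro mult_left_mono) auto
    also have "\<dots> = t * p' x + e" using t by (simp add: field_simps)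
    finally show "p' (t *\<^sub>R x) \<le> t * p' x + e" .
  qed
  have z: "p' 0 = 0"
  proof (rule antisym)
    show "p' 0 \<le> 0" using up[OF zero, of 0] sublinear_zero[OF p] by simp
    show "0 \<le> p' 0" unfolding p'_def using low[of _ 0] zero sublinear_zero[OF p]
      by (intro cINF_greatest) auto
  qed
  have "sublinear p'"
    unfolding sublinear_def
  proof (intro conjI allI impI)
    fix x y
    show "p' (x + y) \<le> p' x + p' y"
    proof (rule field_le_epsilon)
      fix e :: real assume "e > 0"
      then obtain v a w b where va: "(v, a) \<in> C" "p (x + v) - a < p' x + e / 2"
        and wb: "(w, b) \<in> C" "p (y + w) - b < p' y + e / 2"
        using near[of "e / 2" x] near[of "e / 2" y] by auto
      have "p' (x + y) \<le> p ((x + y) + (v + w)) - (a + b)" by (rule up) (use add va wb in auto)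
      also have "(x + y) + (v + w) = (x + v) + (y + w)" by simp
      finally show "p' (x + y) \<le> p' x + p' y + e"
        using sublinear_add[OF p, of "x + v" "y + w"] va wb by linarith
    qed
  next
    fix t :: real and x assume "0 \<le> t"
    show "p' (t *\<^sub>R x) = t * p' x"
    proof (cases "t = 0")
      case True
      then show ?thesis using z by simp
    next
      case False
      then have t: "0 < t" using \<open>0 \<le> t\<close> by simp
      then have "p' x \<le> inverse t * p' (t *\<^sub>R x)" using sc[of "inverse t" "t *\<^sub>R x"] by simp
      then have "t * p' x \<le> p' (t *\<^sub>R x)" using t by (simp add: field_simps)
      then show ?thesis using sc[OF t] by (simp add: antisym)
    qed
  qed
  then show ?thesis
  proof (rule that)
    show "p' x \<le> p x" for x using up[OF zero, of x] by simp
  qed (rule up)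
qed

text \<open>If \<open>p\<close> is minimal, then lowering it along the ray through \<open>(y, p y)\<close> changes nothing, and
  this says \<open>p x \<le> p (x + y) - p y\<close>. So \<open>p\<close> is superadditive as well as subadditive.\<close>

lemma minimal_sublinear_linear:
  fixes p :: "'v::real_vector \<Rightarrow> real"
  assumes p: "sublinear p" and min: "\<And>p'. sublinear p' \<Longrightarrow> (\<And>x. p' x \<le> p x) \<Longrightarrow> p' = p"
  shows "linear p"
proof -
  have super: "p x + p y \<le> p (x + y)" for x y
  proof -
    define C where "C = {(t *\<^sub>R y, t * p y) | t. 0 \<le> t}"
    have zero: "(0, 0) \<in> C" unfolding C_def by (auto intro: exI[of _ "0::real"])
    have add: "(v + w, a + b) \<in> C" if "(v, a) \<in> C" "(w, b) \<in> C" for v a w b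
    proof -
      from that obtain s t where "0 \<le> s" "0 \<le> t" "v = s *\<^sub>R y" "a = s * p y" "w = t *\<^sub>R y" "b = t * p y"
        unfolding C_def by auto
      then show ?thesis unfolding C_def by (auto simp: algebra_simps intro!: exI[of _ "s + t"])
    qed
    have scale: "(t *\<^sub>R v, t * a) \<in> C" if t: "0 \<le> t" "(v, a) \<in> C" for t v a
    proof -
      from that obtain s where "0 \<le> s" "v = s *\<^sub>R y" "a = s * p y" unfolding C_def by auto
      then show ?thesis unfolding C_def using t by (auto intro!: exI[of _ "t * s"])
    qed
    have dom: "a \<le> p v" if "(v, a) \<in> C" for v a
      using that sublinear_scale[OF p] by (auto simp: C_def)
    obtain p' where p': "sublinear p'" "\<And>x. p' x \<le> p x"
      "\<And>x v a. (v, a) \<in> C \<Longrightarrow> p' x \<le> p (x + v) - a"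
      using sublinear_improve[OF p zero add scale dom] by blast
    have "(1 *\<^sub>R y, 1 * p y) \<in> C" unfolding C_def by force
    then have "p' x \<le> p (x + y) - p y" using p'(3)[of y "p y" x] by simp
    moreover have "p' = p" using min p'(1,2) by blast
    ultimately show ?thesis by simp
  qed
  then have add: "p (x + y) = p x + p y" for x y
    using sublinear_add[OF p] by (meson antisym)
  have neg: "p (- x) = - p x" for x
    using add[of x "- x"] sublinear_zero[OF p] by simp
  have "p (t *\<^sub>R x) = t * p x" for t x
  proof (cases "0 \<le> t")
    case True
    then show ?thesis using sublinear_scale[OF p] by simp
  next
    case False
    then show ?thesis using sublinear_scale[OF p, of "- t" x] neg[of "t *\<^sub>R x"] by simp
  qed
  then show ?thesis using add by (intro linearI) auto
qed

text \<open>By Zorn's lemma there is a minimal sublinear functional below \<open>p\<close>; the pointwise infimum of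
  a chain of sublinear functionals is sublinear, because two members of a chain can be replaced by
  the smaller one.\<close>

lemma sublinear_dominates_linear:
  fixes p :: "'v::real_vector \<Rightarrow> real"
  assumes p: "sublinear p"
  obtains l where "linear l" "\<And>x. l x \<le> p x"
proof -
  define A where "A = {s. sublinear s \<and> (\<forall>x. s x \<le> p x)}"
  define P where "P = (\<lambda>s s' :: 'v \<Rightarrow> real. s' \<le> s)"
  have po: "partial_order_on A (relation_of P A)"
    unfolding P_def by (rule partial_order_on_relation_ofI)
      (auto simp: le_fun_def intro: order_trans antisym)
  have "\<exists>m\<in>A. \<forall>a\<in>A. P m a \<longrightarrow> a = m"
  proof (rule predicate_Zorn[OF po])
    fix C assume C: "C \<in> Chains (relation_of P A)"
    then have CA: "C \<subseteq> A" and ch: "\<And>s s'. s \<in> C \<Longrightarrow> s' \<in> C \<Longrightarrow> s' \<le> s \<or> s \<le> s'"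
      unfolding Chains_def relation_of_def P_def by auto
    show "\<exists>u\<in>A. \<forall>a\<in>C. P a u"
    proof (cases "C = {}")
      case True
      then show ?thesis using p by (intro bexI[of _ p]) (auto simp: A_def)
    next
      case False
      define u where "u x = (INF s\<in>C. s x)" for x
      have bdd: "bdd_below ((\<lambda>s. s x) ` C)" for x
      proof (rule bdd_belowI2)
        fix s assume "s \<in> C"
        then have "sublinear s" "s (- x) \<le> p (- x)" using CA by (auto simp: A_def)
        then show "- p (- x) \<le> s x" using sublinear_lower[of s x] by linarith
      qed
      have u_le: "u x \<le> s x" if "s \<in> C" for s x
        unfolding u_def by (rule cINF_lower[OF bdd that])
      have near: "\<exists>s\<in>C. s x < u x + e" if "e > 0" for x e
      proof (rule ccontr)
        assume "\<not> ?thesis"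
        then have "u x + e \<le> u x" unfolding u_def[of x] using False
          by (intro cINF_greatest) (auto simp: not_less)
        then show False using that by simp
      qed
      have "sublinear u"
        unfolding sublinear_def
      proof (intro conjI allI impI)
        fix x y
        show "u (x + y) \<le> u x + u y"
        proof (rule field_le_epsilon)
          fix e :: real assume "e > 0"
          then obtain s s' where s: "s \<in> C" "s x < u x + e / 2" "s' \<in> C" "s' y < u y + e / 2"
            using near[of "e / 2" x] near[of "e / 2" y] by auto
          obtain m where m: "m \<in> C" "m \<le> s" "m \<le> s'" using ch[OF s(1,3)] s by auto
          have "u (x + y) \<le> m (x + y)" using m u_le by blast
          also have "\<dots> \<le> m x + m y" using m CA by (auto simp: A_def intro: sublinear_add)
          also have "\<dots> \<le> s x + s' y" using m by (intro add_mono) (auto simp: le_fun_def)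
          finally show "u (x + y) \<le> u x + u y + e" using s by linarith
        qed
      next
        fix t :: real and x assume t: "0 \<le> t"
        have "u (t *\<^sub>R x) = (INF s\<in>C. t * s x)"
          unfolding u_def by (rule INF_cong) (use CA t in \<open>auto simp: A_def sublinear_scale\<close>)
        also have "\<dots> = t * u x"
        proof (cases "t = 0")
          case True
          then show ?thesis using False by simp
        next
          case False
          then have "0 < t" using t by simp
          show ?thesis
          proof (rule antisym)
            have "(INF s\<in>C. t * s x) / t \<le> u x" unfolding u_def
            proof (rule cINF_greatest)
              fix s assume "s \<in> C"
              obtain b where "\<And>s. s \<in> C \<Longrightarrow> b \<le> s x" using bdd[of x] unfolding bdd_below_def by auto
              then have "bdd_below ((\<lambda>s. t * s x) ` C)" using t
                by (intro bdd_belowI2[of _ "t * b"]) (auto intro: mult_left_mono)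
              from cINF_lower[OF this \<open>s \<in> C\<close>] show "(INF s\<in>C. t * s x) / t \<le> s x"
                using \<open>0 < t\<close> by (simp add: field_simps)
            qed fact
            then show "(INF s\<in>C. t * s x) \<le> t * u x" using \<open>0 < t\<close> by (simp add: field_simps)
            show "t * u x \<le> (INF s\<in>C. t * s x)"
              using u_le t \<open>C \<noteq> {}\<close> by (intro cINF_greatest) (auto intro: mult_left_mono)
          qed
        qed
        finally show "u (t *\<^sub>R x) = t * u x" .
      qed
      moreover have "u x \<le> p x" for x
      proof -
        obtain s where "s \<in> C" using False by blast
        then have "u x \<le> s x" "s x \<le> p x" using u_le CA by (auto simp: A_def)
        then show ?thesis by linarith
      qed
      ultimately have "u \<in> A" by (simp add: A_def)
      then show ?thesis using u_le by (auto simp: P_def le_fun_def)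
    qed
  qed
  then obtain m where m: "m \<in> A" "\<And>a. a \<in> A \<Longrightarrow> a \<le> m \<Longrightarrow> a = m" unfolding P_def by blast
  have "linear m"
  proof (rule minimal_sublinear_linear)
    show "sublinear m" using m by (simp add: A_def)
    fix p' assume "sublinear p'" "\<And>x. p' x \<le> m x"
    then show "p' = m" using m by (intro m(2)) (auto simp: A_def le_fun_def intro: order_trans)
  qed
  then show ?thesis using that m by (auto simp: A_def)
qed

text \<open>The Hahn-Banach theorem for a linear functional that is given on the source of a linear map
  \<open>i\<close>, so that no subspace has to be mentioned: lower \<open>p\<close> along the graph of \<open>\<phi>\<close> until every
  linear functional below it must agree with \<open>\<phi>\<close>.\<close>

lemma hahn_banach:
  fixes p :: "'v::real_vector \<Rightarrow> real" and i :: "'z::real_vector \<Rightarrow> 'v"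
  assumes p: "sublinear p" and i: "linear i" and \<phi>: "linear \<phi>" and dom: "\<And>z. \<phi> z \<le> p (i z)"
  obtains l where "linear l" "\<And>x. l x \<le> p x" "\<And>z. l (i z) = \<phi> z"
proof -
  define C where "C = range (\<lambda>z. (i z, \<phi> z))"
  have zero: "(0, 0) \<in> C"
    unfolding C_def by (rule range_eqI[of _ _ 0]) (simp add: linear_0[OF i] linear_0[OF \<phi>])
  have add: "(v + w, a + b) \<in> C" if "(v, a) \<in> C" "(w, b) \<in> C" for v a w b
    using that unfolding C_def by (auto simp flip: linear_add[OF i] linear_add[OF \<phi>])
  have scale: "(t *\<^sub>R v, t * a) \<in> C" if va: "(v, a) \<in> C" for t v a
  proof -
    obtain z where "v = i z" "a = \<phi> z" using va unfolding C_def by blast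
    then show ?thesis
      unfolding C_def by (intro range_eqI[of _ _ "t *\<^sub>R z"]) (simp add: linear_cmul[OF i] linear_cmul[OF \<phi>])
  qed
  have dom': "a \<le> p v" if "(v, a) \<in> C" for v a
    using that dom by (auto simp: C_def)
  obtain p' where p': "sublinear p'" "\<And>x. p' x \<le> p x"
    "\<And>x v a. (v, a) \<in> C \<Longrightarrow> p' x \<le> p (x + v) - a"
    using sublinear_improve[OF p zero add scale dom'] by blast
  obtain l where l: "linear l" "\<And>x. l x \<le> p' x" using sublinear_dominates_linear[OF p'(1)] by blast
  have le: "l (i z) \<le> \<phi> z" for z
  proof -
    have "(i (- z), \<phi> (- z)) \<in> C" by (simp add: C_def)
    then have "p' (i z) \<le> p (i z + i (- z)) - \<phi> (- z)" by (rule p'(3))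
    also have "\<dots> = \<phi> z"
      by (simp add: linear_neg[OF i] linear_neg[OF \<phi>] sublinear_zero[OF p])
    finally show ?thesis using l(2)[of "i z"] by linarith
  qed
  have "l (i z) = \<phi> z" for z
    using le[of z] le[of "- z"] by (simp add: linear_neg[OF i] linear_neg[OF \<phi>] linear_neg[OF l(1)])
  then show ?thesis using that l p'(2) by (meson order_trans)
qed

text \<open>The open mapping theorem for operators with closed range, as a bound on the size of
  solutions of \<open>T x = y\<close>. By Baire's theorem the closure of the image of some ball has interior in
  the range. Hence every \<open>y\<close> in the range is solved up to an error of half its norm by some \<open>x\<close> of
  comparable norm, and iterating on the error gives a geometric series of corrections.\<close>

lemma open_mapping:
  fixes T :: "'a::banach \<Rightarrow> 'b::banach"
  assumes T: "bounded_linear T" and cl: "closed (range T)"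
  obtains M where "M > 0" "\<And>y. y \<in> range T \<Longrightarrow> \<exists>x. T x = y \<and> norm x \<le> M * norm y"
proof -
  interpret T: bounded_linear T by fact
  let ?S = "range T"
  have sub: "subspace ?S" using T.linear_axioms by (simp add: linear_subspace_image)
  define G where "G n = closure (T ` cball 0 (real n))" for n
  have GS: "G n \<subseteq> ?S" for n unfolding G_def using cl by (intro closure_minimal) auto
  have "\<exists>n. top_of_set ?S interior_of G n \<noteq> {}"
  proof (rule ccontr)
    assume no: "\<not> ?thesis"
    have "top_of_set ?S interior_of \<Union>(range G) = {}"
    proof (rule Baire_category_alt)
      show "completely_metrizable_space (top_of_set ?S) \<or>
          locally_compact_space (top_of_set ?S) \<and> regular_space (top_of_set ?S)"
        using cl completely_metrizable_space_closedin completely_metrizable_space_euclidean closed_closedin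
          by blast
      fix X assume "X \<in> range G"
      then show "closedin (top_of_set ?S) X \<and> top_of_set ?S interior_of X = {}"
        using no GS by (auto simp: G_def closed_subset)
    qed auto
    moreover have "\<Union>(range G) = ?S"
    proof
      show "?S \<subseteq> \<Union>(range G)"
      proof
        fix y assume "y \<in> ?S"
        then obtain x where x: "y = T x" by blast
        obtain n where "norm x \<le> real n" using real_arch_simple by blast
        then have "y \<in> G n" unfolding G_def x by (intro closure_subset[THEN subsetD]) auto
        then show "y \<in> \<Union>(range G)" by blast
      qed
    qed (use GS in blast)
    ultimately have "?S = {}" by (metis interior_of_topspace topspace_euclidean_subtopology)
    then show False by blast
  qed
  then obtain n y0 where "y0 \<in> top_of_set ?S interior_of G n" by blast
  then obtain U where U: "openin (top_of_set ?S) U" "y0 \<in> U" "U \<subseteq> G n"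
    unfolding interior_of_def by blast
  then obtain e where e: "e > 0" "ball y0 e \<inter> ?S \<subseteq> U" "y0 \<in> ?S"
    unfolding openin_contains_ball by blast
  define K where "K = 4 * real n / e"
  have approx: "\<exists>x. norm x \<le> K * norm y \<and> norm (y - T x) \<le> norm y / 2" if y: "y \<in> ?S" for y
  proof (cases "y = 0")
    case True
    then show ?thesis by (intro exI[of _ 0]) (simp add: T.zero)
  next
    case False
    \<comment> \<open>Rescale \<open>y\<close> so that \<open>y0 + c y\<close> lies in the ball around \<open>y0\<close>, and subtract approximate
      solutions for \<open>y0 + c y\<close> and \<open>y0\<close>.\<close>
    define c where "c = e / (2 * norm y)"
    have c: "c > 0" "c * norm y = e / 2" using False e by (auto simp: c_def)
    have "y0 + c *\<^sub>R y \<in> ball y0 e" using c e by (simp add: dist_norm)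
    moreover have "y0 + c *\<^sub>R y \<in> ?S" using sub y e by (simp add: subspace_add subspace_scale)
    ultimately have "y0 + c *\<^sub>R y \<in> G n" "y0 \<in> G n" using e(2) U(2,3) by blast+
    moreover have "c * norm y / 4 > 0" using c False by simp
    ultimately have "\<exists>z\<in>T ` cball 0 n. dist z (y0 + c *\<^sub>R y) < c * norm y / 4"
      "\<exists>z\<in>T ` cball 0 n. dist z y0 < c * norm y / 4"
      unfolding G_def closure_approachable by blast+
    then obtain a b where a: "norm a \<le> n" "dist (T a) (y0 + c *\<^sub>R y) < c * norm y / 4"
      and b: "norm b \<le> n" "dist (T b) y0 < c * norm y / 4"
      by auto
    define x where "x = (1 / c) *\<^sub>R (a - b)"
    have "norm (c *\<^sub>R y - T (a - b)) = norm ((y0 + c *\<^sub>R y - T a) + (T b - y0))"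
      by (simp add: T.diff algebra_simps)
    also have "\<dots> \<le> c * norm y / 4 + c * norm y / 4"
      using norm_triangle_ineq[of "y0 + c *\<^sub>R y - T a" "T b - y0"] a b
        by (simp add: dist_norm norm_minus_commute)
    also have "\<dots> = c * (norm y / 2)" by simp
    finally have 1: "norm (c *\<^sub>R y - T (a - b)) \<le> c * (norm y / 2)" .
    have "T (a - b) = c *\<^sub>R T x" using c by (simp add: x_def flip: T.scaleR)
    then have "c *\<^sub>R y - T (a - b) = c *\<^sub>R (y - T x)" by (simp add: scaleR_diff_right)
    then have "c * norm (y - T x) \<le> c * (norm y / 2)" using 1 c(1) by (simp only: norm_scaleR abs_of_pos)
    then have 2: "norm (y - T x) \<le> norm y / 2" using c by (simp only: mult_le_cancel_left_pos)
    have "norm x = norm (a - b) / c" using c by (simp add: x_def)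
    also have "\<dots> \<le> (2 * real n) / c"
      using norm_triangle_ineq4[of a b] a b c by (intro divide_right_mono) auto
    also have "\<dots> = K * norm y" using False by (simp add: K_def c_def)
    finally show ?thesis using 2 by blast
  qed
  then obtain g where g: "\<And>y. y \<in> ?S \<Longrightarrow> norm (g y) \<le> K * norm y"
    "\<And>y. y \<in> ?S \<Longrightarrow> norm (y - T (g y)) \<le> norm y / 2" by metis
  have K0: "0 \<le> K" using e by (simp add: K_def)
  have solve: "\<exists>x. T x = y \<and> norm x \<le> (2 * K + 1) * norm y" if y: "y \<in> ?S" for y
  proof -
    define r where "r k = ((\<lambda>z. z - T (g z)) ^^ k) y" for k
    have r0: "r 0 = y" and rS: "r (Suc k) = r k - T (g (r k))" for k by (simp_all add: r_def)
    have r_in: "r k \<in> ?S" for k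
      by (induction k) (use y sub in \<open>auto simp: r0 rS intro: subspace_diff\<close>)
    have r_norm: "norm (r k) \<le> norm y * (1/2) ^ k" for k
    proof (induction k)
      case (Suc k)
      then show ?case using g(2)[OF r_in, of k] by (simp add: rS)
    qed (simp add: r0)
    have gr: "norm (g (r k)) \<le> K * norm y * (1/2) ^ k" for k
      using g(1)[OF r_in, of k] mult_left_mono[OF r_norm[of k] K0] by (simp add: mult.assoc)
    have geo: "(\<lambda>k. K * norm y * (1/2) ^ k) sums (2 * K * norm y)"
      using sums_mult[OF power_half_series] geometric_sums[of "1/2::real"]
        sums_mult[of "\<lambda>k. (1/2::real)^k" 2 "K * norm y"]
      by (simp add: mult.commute mult.left_commute)
    have summ: "summable (\<lambda>k. g (r k))"
      by (rule summable_comparison_test'[OF sums_summable[OF geo], of 0]) (use gr in auto)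
    define x where "x = (\<Sum>k. g (r k))"
    have "norm x \<le> (\<Sum>k. K * norm y * (1/2) ^ k)"
      unfolding x_def by (rule norm_suminf_le[OF gr sums_summable[OF geo]])
    also have "\<dots> = 2 * K * norm y" using geo by (simp add: sums_iff)
    finally have nx: "norm x \<le> (2 * K + 1) * norm y" by (simp add: algebra_simps add_increasing)
    have part: "(\<Sum>k<m. T (g (r k))) = y - r m" for m
      by (induction m) (auto simp: r0 rS)
    have "(\<lambda>k. T (g (r k))) sums T x"
      unfolding x_def using T.sums[OF summable_sums[OF summ]] .
    moreover have "r \<longlonglongrightarrow> 0"
    proof (rule Lim_null_comparison)
      show "\<forall>\<^sub>F k in sequentially. norm (r k) \<le> norm y * (1/2) ^ k" using r_norm by simp
      show "(\<lambda>k. norm y * (1/2) ^ k) \<longlonglongrightarrow> 0"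
        by (intro tendsto_mult_right_zero LIMSEQ_power_zero) simp
    qed
    then have "(\<lambda>k. T (g (r k))) sums y"
      unfolding sums_def part using tendsto_diff[OF tendsto_const, of r 0 sequentially y] by simp
    ultimately have "T x = y" by (rule sums_unique2)
    then show ?thesis using nx by blast
  qed
  show ?thesis
  proof (rule that)
    show "2 * K + 1 > 0" using K0 by simp
  qed (rule solve)
qed

section \<open>Compact spaces of height 3\<close>

definition derived :: "'a::topological_space set \<Rightarrow> 'a set" where
  "derived S = {x. x islimpt S}"

lemma derived_mono: "S \<subseteq> T \<Longrightarrow> derived S \<subseteq> derived T"
  unfolding derived_def using islimpt_subset by blast

lemma closed_derived: "closed (derived (S :: 'a::t1_space set))"
  unfolding closed_limpt
proof (intro allI impI)
  fix x assume x: "x islimpt derived S"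
  show "x \<in> derived S"
    unfolding derived_def mem_Collect_eq islimpt_eq_acc_point
  proof (intro allI impI)
    fix V assume V: "x \<in> V" "open V"
    then obtain y where "y \<in> derived S" "y \<in> V" using x unfolding islimpt_def by blast
    then show "infinite (V \<inter> S)"
      using V unfolding derived_def mem_Collect_eq islimpt_eq_acc_point by blast
  qed
qed

lemma derived_UNIV: "x \<notin> derived UNIV \<longleftrightarrow> open {x}"
  by (simp add: derived_def islimpt_UNIV_iff)

lemma compact_disjoint_derived_finite:
  fixes C :: "'a::topological_space set"
  assumes "compact C" "C \<inter> derived C = {}"
  shows "finite C"
  using finite_not_islimpt_in_compact[of C C] assms by (auto simp: derived_def)

lemma has_cb_height_3_derived:
  assumes "has_cb_height (UNIV :: 'a::topological_space set) 3"
  shows "derived (derived (derived (UNIV :: 'a set))) = {}" "derived (derived (UNIV :: 'a set)) \<noteq> {}"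
proof -
  have 1: "cb_derivative UNIV 1 = derived (UNIV :: 'a set)"
    by (simp add: derived_def)
  have sub2: "derived (derived UNIV) \<subseteq> derived (UNIV :: 'a set)" by (rule derived_mono) simp
  then have 2: "cb_derivative UNIV 2 = derived (derived (UNIV :: 'a set))"
    using 1 by (auto simp: numeral_2_eq_2 derived_def)
  have "derived (derived (derived UNIV)) \<subseteq> derived (derived (UNIV :: 'a set))"
    by (rule derived_mono[OF sub2])
  then have 3: "cb_derivative UNIV 3 = derived (derived (derived (UNIV :: 'a set)))"
    using 2 by (auto simp: numeral_3_eq_3 numeral_2_eq_2 derived_def)
  show "derived (derived (derived (UNIV :: 'a set))) = {}"
    using assms 3 by (simp add: has_cb_height_def)
  show "derived (derived (UNIV :: 'a set)) \<noteq> {}"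
    using assms 2 unfolding has_cb_height_def by (metis less_add_one numeral_plus_one semiring_norm(5))
qed

lemma countable_isolated_points:
  assumes "separable_space (euclidean :: 'a::topological_space topology)"
  shows "countable (- derived (UNIV :: 'a set))"
proof -
  obtain C :: "'a set" where C: "countable C" "closure C = UNIV"
    using assms by (auto simp: separable_space_def)
  have "- derived UNIV \<subseteq> C"
  proof
    fix x :: 'a assume "x \<in> - derived UNIV"
    then have "open {x}" using derived_UNIV by blast
    then show "x \<in> C" using C(2) open_Int_closure_eq_empty[of "{x}" C] by auto
  qed
  then show ?thesis using C(1) countable_subset by blast
qed

lemma Hausdorff_space_euclidean_t2: "Hausdorff_space (euclidean :: 'a::t2_space topology)"
  unfolding Hausdorff_space_def disjnt_def using hausdorff by auto

text \<open>Separate \<open>\<xi>\<close> from the closed set of the remaining limit points by disjoint open sets \<open>V\<close> and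
  \<open>W\<close>. A boundary point of \<open>V\<close> would be a limit point of the space other than \<open>\<xi>\<close>, hence would lie
  in \<open>W\<close>, which no point of the closure of \<open>V\<close> does. So \<open>V\<close> is already closed.\<close>

lemma isolating_clopen:
  fixes \<xi> :: "'a::t2_space"
  assumes K: "compact (UNIV :: 'a set)" and \<xi>: "\<xi> \<in> derived UNIV" "\<xi> \<notin> derived (derived UNIV)"
  obtains U where "open U" "closed U" "U \<inter> derived UNIV = {\<xi>}"
proof -
  let ?T = "derived UNIV - {\<xi>}"
  have closed_T: "closed ?T"
    unfolding closed_limpt
  proof (intro allI impI)
    fix x assume "x islimpt ?T"
    then have "x islimpt derived UNIV" by (meson islimpt_subset Diff_subset)
    then have "x \<in> derived UNIV" "x \<in> derived (derived UNIV)"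
      using closed_derived[of UNIV] by (auto simp: closed_limpt derived_def)
    then show "x \<in> ?T" using \<xi> by auto
  qed
  have "regular_space (euclidean :: 'a topology)"
    using K by (intro compact_Hausdorff_imp_regular_space)
      (auto simp: compact_space_def Hausdorff_space_euclidean_t2)
  then have "\<exists>U V. openin euclidean U \<and> openin euclidean V \<and> \<xi> \<in> U \<and> ?T \<subseteq> V \<and> disjnt U V"
    using closed_T unfolding regular_space_def by auto
  then obtain V W where VW: "open V" "open W" "\<xi> \<in> V" "?T \<subseteq> W" "V \<inter> W = {}"
    by (auto simp: disjnt_def)
  have "closed V"
  proof -
    have "x \<in> V" if x: "x islimpt V" for x
    proof -
      have "x islimpt UNIV" using x islimpt_subset by blast
      then have "x \<in> derived UNIV" by (simp add: derived_def)
      moreover have "x \<notin> W" using x VW unfolding islimpt_def by blast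
      ultimately show ?thesis using VW by blast
    qed
    then show ?thesis unfolding closed_limpt by blast
  qed
  moreover have "V \<inter> derived UNIV = {\<xi>}" using VW \<xi> by blast
  ultimately show ?thesis using that VW by blast
qed

text \<open>The indicator function as an element of the Banach space; a junk value unless the set is clopen.\<close>

definition clopen_indicator :: "'a::topological_space set \<Rightarrow> 'a \<Rightarrow>\<^sub>C real" where
  "clopen_indicator U = Bcontfun (indicator U)"

lemma clopen_indicator_apply:
  assumes "open U" "closed U"
  shows "apply_bcontfun (clopen_indicator U) x = indicator U x"
proof -
  have "indicator U = (\<lambda>x. if x \<in> U then 1 else (0::real))" by (auto simp: indicator_def)
  moreover have "continuous_on (U \<union> - U) (\<lambda>x. if x \<in> U then 1 else (0::real))"
    by (rule continuous_on_cases) (use assms in auto)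
  ultimately have "(indicator U :: 'a \<Rightarrow> real) \<in> bcontfun"
    by (intro bcontfun_normI[of _ 1]) (auto simp: indicator_def)
  then show ?thesis by (simp add: clopen_indicator_def Bcontfun_inverse)
qed

lemma linear_apply_bcontfun: "linear (\<lambda>g :: 'a::topological_space \<Rightarrow>\<^sub>C real. apply_bcontfun g x)"
  by (intro linearI) auto

lemma sum_apply_bcontfun:
  "apply_bcontfun (\<Sum>i\<in>I. a i *\<^sub>R g i) x = (\<Sum>i\<in>I. a i * apply_bcontfun (g i) x)"
  for g :: "'i \<Rightarrow> 'a::topological_space \<Rightarrow>\<^sub>C real"
  using linear_sum[OF linear_apply_bcontfun, of "\<lambda>i. a i *\<^sub>R g i" I x] by simp

lemma norm_sum_disjoint_indicators_le:
  fixes V :: "'i \<Rightarrow> 'a::topological_space set"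
  assumes "finite I" and V: "\<And>i. i \<in> I \<Longrightarrow> open (V i) \<and> closed (V i)"
    and disj: "\<And>i j. i \<in> I \<Longrightarrow> j \<in> I \<Longrightarrow> i \<noteq> j \<Longrightarrow> V i \<inter> V j = {}"
    and \<sigma>: "\<And>i. i \<in> I \<Longrightarrow> \<bar>\<sigma> i\<bar> \<le> 1"
  shows "norm (\<Sum>i\<in>I. \<sigma> i *\<^sub>R clopen_indicator (V i)) \<le> 1"
proof (rule norm_bound)
  fix x
  have eq: "apply_bcontfun (\<Sum>i\<in>I. \<sigma> i *\<^sub>R clopen_indicator (V i)) x = (\<Sum>i\<in>I. \<sigma> i * indicator (V i) x)"
    unfolding sum_apply_bcontfun by (rule sum.cong) (use V in \<open>auto simp: clopen_indicator_apply\<close>)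
  show "norm (apply_bcontfun (\<Sum>i\<in>I. \<sigma> i *\<^sub>R clopen_indicator (V i)) x) \<le> 1"
  proof (cases "\<exists>j\<in>I. x \<in> V j")
    case True
    then obtain j where j: "j \<in> I" "x \<in> V j" by blast
    have "(\<Sum>i\<in>I. \<sigma> i * indicator (V i) x) = (\<Sum>i\<in>I. if i = j then \<sigma> i else 0)"
      by (rule sum.cong) (use disj j in \<open>auto simp: indicator_def\<close>)
    then show ?thesis unfolding eq using \<sigma> j \<open>finite I\<close> by simp
  next
    case False
    then have "(\<Sum>i\<in>I. \<sigma> i * indicator (V i) x) = 0" by (intro sum.neutral) auto
    then show ?thesis unfolding eq by simp
  qed
qed

lemma urysohn_function:
  fixes p :: "'a::t2_space"
  assumes K: "compact (UNIV :: 'a set)" and "finite F" "p \<notin> F"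
  obtains \<phi> :: "'a \<Rightarrow>\<^sub>C real" where "apply_bcontfun \<phi> p = 1" "\<And>x. x \<in> F \<Longrightarrow> apply_bcontfun \<phi> x = 0"
proof -
  have "normal_space (euclidean :: 'a topology)"
    using K by (intro compact_Hausdorff_or_regular_imp_normal_space)
      (auto simp: compact_space_def Hausdorff_space_euclidean_t2)
  then obtain f where f: "continuous_map euclidean (top_of_set {0..1::real}) f" "f ` F \<subseteq> {0}" "f ` {p} \<subseteq> {1}"
    by (rule Urysohn_lemma[of euclidean F "{p}" 0 1]) (use assms in \<open>auto simp: finite_imp_closed\<close>)
  then have "continuous_on UNIV f" "\<And>x. f x \<in> {0..1}"
    by (auto simp: continuous_map_in_subtopology)
  then have "f \<in> bcontfun" by (intro bcontfun_normI[of _ 1]) auto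
  then show ?thesis using f by (intro that[of "Bcontfun f"]) (auto simp: Bcontfun_inverse)
qed

text \<open>When the second derived set is finite, a continuous \<open>g\<close> is approximated by treating one
  derived set after the other. Subtracting multiples of the \<open>\<phi> p\<close> makes \<open>g\<close> vanish on \<open>K2\<close>. Then
  \<open>{\<bar>g\<bar> \<ge> \<epsilon>}\<close> meets \<open>K1\<close> in a compact set that misses \<open>K2\<close>, hence in a finite set, and subtracting
  multiples of finitely many indicators of \<open>U \<xi>\<close> makes \<open>g\<close> smaller than \<open>\<epsilon>\<close> on \<open>K1\<close>. The same
  argument with \<open>UNIV\<close> and \<open>K1\<close> in the place of \<open>K1\<close> and \<open>K2\<close> leaves finitely many isolated
  points.\<close>

lemma dense_span_generators:
  fixes U :: "'a::t2_space \<Rightarrow> 'a set" and \<phi> :: "'a \<Rightarrow> 'a \<Rightarrow>\<^sub>C real"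
  defines "K1 \<equiv> derived (UNIV :: 'a set)" and "K2 \<equiv> derived (derived (UNIV :: 'a set))"
  assumes K: "compact (UNIV :: 'a set)" and fin: "finite K2"
    and \<phi>: "\<And>p x. p \<in> K2 \<Longrightarrow> x \<in> K2 \<Longrightarrow> apply_bcontfun (\<phi> p) x = (if x = p then 1 else 0)"
    and U: "\<And>\<xi>. \<xi> \<in> K1 - K2 \<Longrightarrow> open (U \<xi>) \<and> closed (U \<xi>) \<and> U \<xi> \<inter> K1 = {\<xi>}"
  shows "closure (span ((\<lambda>d. clopen_indicator {d}) ` (- K1) \<union> (\<lambda>\<xi>. clopen_indicator (U \<xi>)) ` (K1 - K2)
    \<union> \<phi> ` K2)) = UNIV"
    (is "closure (span ?G) = UNIV")
proof -
  have "\<exists>y\<in>span ?G. dist y g \<le> \<epsilon>" if \<epsilon>: "\<epsilon> > 0" for g :: "'a \<Rightarrow>\<^sub>C real" and \<epsilon>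
  proof -
    have closed_ge: "closed {x. \<epsilon> \<le> \<bar>apply_bcontfun u x\<bar>}" for u :: "'a \<Rightarrow>\<^sub>C real"
      by (intro closed_Collect_le continuous_intros) auto
    have cmp: "compact C" if "closed C" for C :: "'a set" using that K compact_Int_closed[of UNIV C] by simp
    define y1 where "y1 = (\<Sum>p\<in>K2. apply_bcontfun g p *\<^sub>R \<phi> p)"
    define g1 where "g1 = g - y1"
    have g1: "apply_bcontfun g1 x = 0" if "x \<in> K2" for x
    proof -
      have "apply_bcontfun y1 x = (\<Sum>p\<in>K2. if x = p then apply_bcontfun g p else 0)"
        unfolding y1_def sum_apply_bcontfun by (rule sum.cong) (use \<phi> that in auto)
      then show ?thesis using that fin by (simp add: g1_def)
    qed
    define F1 where "F1 = {x. \<epsilon> \<le> \<bar>apply_bcontfun g1 x\<bar>} \<inter> K1"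
    have F1_disj: "F1 \<inter> K2 = {}" using g1 \<epsilon> by (auto simp: F1_def)
    have "finite F1"
    proof (rule compact_disjoint_derived_finite)
      show "compact F1" unfolding F1_def K1_def by (intro cmp closed_Int closed_ge closed_derived)
      have "derived F1 \<subseteq> K2" unfolding K2_def K1_def[symmetric] by (rule derived_mono) (auto simp: F1_def)
      then show "F1 \<inter> derived F1 = {}" using F1_disj by blast
    qed
    have F1_sub: "F1 \<subseteq> K1 - K2" using F1_disj by (auto simp: F1_def)
    define y2 where "y2 = (\<Sum>\<xi>\<in>F1. apply_bcontfun g1 \<xi> *\<^sub>R clopen_indicator (U \<xi>))"
    define g2 where "g2 = g1 - y2"
    have g2: "\<bar>apply_bcontfun g2 x\<bar> < \<epsilon>" if x: "x \<in> K1" for x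
    proof -
      have "apply_bcontfun y2 x = (\<Sum>\<xi>\<in>F1. if x = \<xi> then apply_bcontfun g1 \<xi> else 0)"
        unfolding y2_def sum_apply_bcontfun
      proof (rule sum.cong)
        fix \<xi> assume "\<xi> \<in> F1"
        then have "open (U \<xi>)" "closed (U \<xi>)" "U \<xi> \<inter> K1 = {\<xi>}" using U F1_sub by blast+
        moreover from this have "x \<in> U \<xi> \<longleftrightarrow> x = \<xi>" using x by blast
        ultimately show "apply_bcontfun g1 \<xi> * apply_bcontfun (clopen_indicator (U \<xi>)) x
          = (if x = \<xi> then apply_bcontfun g1 \<xi> else 0)"
          by (simp add: clopen_indicator_apply indicator_def)
      qed simp
      then show ?thesis using \<open>finite F1\<close> x \<epsilon> by (auto simp: g2_def F1_def)
    qed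
    define F2 where "F2 = {x. \<epsilon> \<le> \<bar>apply_bcontfun g2 x\<bar>}"
    have F2_disj: "F2 \<inter> K1 = {}" using g2 by (force simp: F2_def)
    have "finite F2"
    proof (rule compact_disjoint_derived_finite)
      show "compact F2" unfolding F2_def by (intro cmp closed_ge)
      have "derived F2 \<subseteq> K1" unfolding K1_def by (rule derived_mono) auto
      then show "F2 \<inter> derived F2 = {}" using F2_disj by blast
    qed
    define y3 where "y3 = (\<Sum>d\<in>F2. apply_bcontfun g2 d *\<^sub>R clopen_indicator {d})"
    have g3: "\<bar>apply_bcontfun (g2 - y3) x\<bar> \<le> \<epsilon>" for x
    proof -
      have "apply_bcontfun y3 x = (\<Sum>d\<in>F2. if x = d then apply_bcontfun g2 d else 0)"
        unfolding y3_def sum_apply_bcontfun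
      proof (rule sum.cong)
        fix d assume "d \<in> F2"
        then have "open {d}" using F2_disj derived_UNIV[of d] by (auto simp: K1_def)
        then show "apply_bcontfun g2 d * apply_bcontfun (clopen_indicator {d}) x
          = (if x = d then apply_bcontfun g2 d else 0)"
          by (simp add: clopen_indicator_apply indicator_def)
      qed simp
      then show ?thesis using \<open>finite F2\<close> \<epsilon> by (auto simp: F2_def)
    qed
    have "y1 \<in> span ?G" unfolding y1_def by (intro span_sum span_scale span_base) auto
    moreover have "y2 \<in> span ?G" unfolding y2_def using F1_sub by (intro span_sum span_scale span_base) auto
    moreover have "y3 \<in> span ?G" unfolding y3_def using F2_disj
      by (intro span_sum span_scale span_base) auto
    ultimately have "y1 + y2 + y3 \<in> span ?G" by (intro span_add)
    moreover have "dist (y1 + y2 + y3) g = norm (g2 - y3)"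
      by (simp add: dist_norm norm_minus_commute g2_def g1_def algebra_simps)
    moreover have "norm (g2 - y3) \<le> \<epsilon>" using g3 by (intro norm_bound) simp
    ultimately show ?thesis by (metis)
  qed
  then have "g \<in> closure (span ?G)" for g
    unfolding closure_approachable using half_gt_zero
      by (metis field_sum_of_halves less_add_same_cancel1 order.strict_trans1)
  then show ?thesis by blast
qed

section \<open>Measures with prescribed masses from Martin's axiom\<close>

text \<open>Finitely supported rational measures on the natural numbers are encoded as lists of pairs
(point, weight). Lists form a countable type, which is what the countable chain condition below rests on.
A point may occur several times, and then \<open>variation\<close> is only an upper bound for the total variation.\<close>

definition mass :: "(nat \<times> rat) list \<Rightarrow> nat set \<Rightarrow> rat" where
  "mass l A = (\<Sum>(k, c)\<leftarrow>l. if k \<in> A then c else 0)"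

definition variation :: "(nat \<times> rat) list \<Rightarrow> rat" where
  "variation l = (\<Sum>(k, c)\<leftarrow>l. \<bar>c\<bar>)"

lemma mass_disjoint: "fst ` set l \<inter> A = {} \<Longrightarrow> mass l A = 0"
  by (induction l) (auto simp: mass_def)

text \<open>Each \<open>A \<xi>\<close> has points beyond \<open>m\<close> that lie in no other \<open>A \<eta>\<close> with \<open>\<eta> \<in> F\<close>; put the weight
  \<open>v \<xi>\<close> on one of them.\<close>

lemma prescribe_masses:
  fixes A :: "'s \<Rightarrow> nat set" and v :: "'s \<Rightarrow> rat"
  assumes "finite F" and inf: "\<And>\<xi>. \<xi> \<in> F \<Longrightarrow> infinite (A \<xi>)"
    and ad: "\<And>\<xi> \<eta>. \<xi> \<in> F \<Longrightarrow> \<eta> \<in> F \<Longrightarrow> \<xi> \<noteq> \<eta> \<Longrightarrow> finite (A \<xi> \<inter> A \<eta>)"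
  obtains l where "variation l = (\<Sum>\<xi>\<in>F. \<bar>v \<xi>\<bar>)" "\<And>\<xi>. \<xi> \<in> F \<Longrightarrow> mass l (A \<xi>) = v \<xi>"
    "\<And>k c. (k, c) \<in> set l \<Longrightarrow> m \<le> k"
proof -
  have "\<exists>k\<in>A \<xi>. m \<le> k \<and> (\<forall>\<eta>\<in>F. \<eta> \<noteq> \<xi> \<longrightarrow> k \<notin> A \<eta>)" if \<xi>: "\<xi> \<in> F" for \<xi>
  proof -
    have "finite ({..<m} \<union> (\<Union>\<eta>\<in>F - {\<xi>}. A \<xi> \<inter> A \<eta>))"
      using \<open>finite F\<close> ad[OF \<xi>] by (intro finite_UnI finite_UN_I) auto
    then obtain k where "k \<in> A \<xi>" "k \<notin> {..<m} \<union> (\<Union>\<eta>\<in>F - {\<xi>}. A \<xi> \<inter> A \<eta>)"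
      using inf[OF \<xi>] by (meson finite_subset subsetI)
    then show ?thesis by (intro bexI[of _ k]) auto
  qed
  then obtain k where k: "\<And>\<xi>. \<xi> \<in> F \<Longrightarrow> k \<xi> \<in> A \<xi> \<and> m \<le> k \<xi>"
    "\<And>\<xi> \<eta>. \<xi> \<in> F \<Longrightarrow> \<eta> \<in> F \<Longrightarrow> \<eta> \<noteq> \<xi> \<Longrightarrow> k \<xi> \<notin> A \<eta>" by metis
  obtain xs where xs: "set xs = F" "distinct xs" using finite_distinct_list[OF \<open>finite F\<close>] by blast
  define l where "l = map (\<lambda>\<xi>. (k \<xi>, v \<xi>)) xs"
  show ?thesis
  proof (rule that)
    show "variation l = (\<Sum>\<xi>\<in>F. \<bar>v \<xi>\<bar>)"
      unfolding variation_def l_def using xs by (simp add: o_def sum_list_distinct_conv_sum_set)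
    show "m \<le> k" if "(k, c) \<in> set l" for k c using that k xs by (auto simp: l_def)
    fix \<xi> assume "\<xi> \<in> F"
    have "mass l (A \<xi>) = (\<Sum>\<eta>\<in>F. if k \<eta> \<in> A \<xi> then v \<eta> else 0)"
      unfolding mass_def l_def using xs by (simp add: o_def sum_list_distinct_conv_sum_set)
    also have "\<dots> = (\<Sum>\<eta>\<in>F. if \<eta> = \<xi> then v \<eta> else 0)"
      by (rule sum.cong) (use k \<open>\<xi> \<in> F\<close> in auto)
    finally show "mass l (A \<xi>) = v \<xi>" using \<open>\<xi> \<in> F\<close> \<open>finite F\<close> by simp
  qed
qed

text \<open>This is the only use of Martin's axiom. A condition \<open>(s, F)\<close> consists of an initial segment
\<open>s\<close> of the sequence \<open>\<mu>\<close> and a finite promise \<open>F\<close>: measures appended later have the mass \<open>h \<xi> n\<close> on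
\<open>A \<xi>\<close> for \<open>\<xi> \<in> F\<close>, and live beyond the length of \<open>s\<close>. A promise may be made once \<open>\<Sum>\<xi>\<in>F. \<bar>h \<xi> n\<bar>\<close>
is at most \<open>C\<close> from the length of \<open>s\<close> on, and it can be kept because the \<open>A \<xi>\<close> are almost
disjoint.

The measures themselves are allowed variation \<open>2 * C\<close>. Because of this slack two conditions
\<open>(s, F)\<close> and \<open>(s, F')\<close> are compatible: the promise \<open>F \<union> F'\<close> costs at most \<open>2 * C\<close> at each of the
steps before its sum drops to \<open>C\<close>, and from there on it is an admissible promise. As there are
only countably many \<open>s\<close>, the poset is ccc.\<close>

lemma martins_axiom_masses:
  fixes \<kappa> :: "'c rel" and S :: "'s set" and A :: "'s \<Rightarrow> nat set" and h :: "'s \<Rightarrow> nat \<Rightarrow> rat"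
  assumes ma: "martins_axiom \<kappa>" and \<kappa>: "Card_order \<kappa>" and card: "|S| \<le>o \<kappa>" and S: "infinite S"
    and inf: "\<And>\<xi>. \<xi> \<in> S \<Longrightarrow> infinite (A \<xi>)"
    and ad: "\<And>\<xi> \<eta>. \<xi> \<in> S \<Longrightarrow> \<eta> \<in> S \<Longrightarrow> \<xi> \<noteq> \<eta> \<Longrightarrow> finite (A \<xi> \<inter> A \<eta>)"
    and h: "\<And>F. finite F \<Longrightarrow> F \<subseteq> S \<Longrightarrow> \<forall>\<^sub>F n in sequentially. (\<Sum>\<xi>\<in>F. \<bar>h \<xi> n\<bar>) \<le> C"
  obtains \<mu> :: "nat \<Rightarrow> (nat \<times> rat) list"
  where "\<And>n. variation (\<mu> n) \<le> 2 * C"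
    "\<And>k. \<forall>\<^sub>F n in sequentially. k \<notin> fst ` set (\<mu> n)"
    "\<And>\<xi>. \<xi> \<in> S \<Longrightarrow> \<forall>\<^sub>F n in sequentially. mass (\<mu> n) (A \<xi>) = h \<xi> n"
proof -
  define ok where "ok m F \<longleftrightarrow> finite F \<and> F \<subseteq> S \<and> (\<forall>n\<ge>m. (\<Sum>\<xi>\<in>F. \<bar>h \<xi> n\<bar>) \<le> C)" for m F
  have ok_eventually: "\<exists>m'\<ge>m. ok m' F" if F: "finite F" "F \<subseteq> S" for m F
  proof -
    obtain N where "\<And>n. n \<ge> N \<Longrightarrow> (\<Sum>\<xi>\<in>F. \<bar>h \<xi> n\<bar>) \<le> C"
      using h[OF F] by (auto simp: eventually_sequentially)
    then show ?thesis using F by (intro exI[of _ "max m N"]) (auto simp: ok_def)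
  qed
  have ok_mono: "ok m' F" if "ok m F" "m \<le> m'" for m m' F
    using that by (auto simp: ok_def)
  define P :: "((nat \<times> rat) list list \<times> 's set) set"
    where "P = {(s, F). ok (length s) F \<and> (\<forall>l\<in>set s. variation l \<le> 2 * C)}"
  define meets where "meets m F n l \<longleftrightarrow> (\<forall>k\<in>fst ` set l. m \<le> k) \<and> (\<forall>\<xi>\<in>F. mass l (A \<xi>) = h \<xi> n)"
    for m :: nat and F n l
  define le where "le = {((s, F), (t, G)) | s F t G. (s, F) \<in> P \<and> (t, G) \<in> P \<and> F \<subseteq> G \<and> (\<exists>u. t = s @ u) \<and>
     (\<forall>n. length s \<le> n \<and> n < length t \<longrightarrow> meets (length s) F n (t ! n))}"
  have le_iff: "((s, F), (t, G)) \<in> le \<longleftrightarrow> (s, F) \<in> P \<and> (t, G) \<in> P \<and> F \<subseteq> G \<and> (\<exists>u. t = s @ u) \<and>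
     (\<forall>n. length s \<le> n \<and> n < length t \<longrightarrow> meets (length s) F n (t ! n))" for s F t G
    by (simp add: le_def)
  have po: "partial_order_on P le"
    unfolding partial_order_on_def preorder_on_def
  proof (intro conjI)
    show "le \<subseteq> P \<times> P" by (auto simp: le_def)
    show "refl_on P le" by (auto simp: refl_on_def le_def)
    show "antisym le" by (rule antisymI) (auto simp: le_def)
    show "trans le"
    proof (rule transI)
      fix x y z assume xy: "(x, y) \<in> le" and yz: "(y, z) \<in> le"
      obtain s F t G w H where [simp]: "x = (s, F)" "y = (t, G)" "z = (w, H)" by (metis surj_pair)
      obtain u u' where u: "t = s @ u" "w = t @ u'" using xy yz by (auto simp: le_iff)
      have "meets (length s) F n (w ! n)" if n: "length s \<le> n" "n < length w" for n
      proof (cases "n < length t")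
        case True
        then show ?thesis using xy n u by (auto simp: le_iff nth_append)
      next
        case False
        then have "meets (length t) G n (w ! n)" using yz n by (auto simp: le_iff)
        then show ?thesis using xy u unfolding meets_def by (fastforce simp: le_iff)
      qed
      then show "(x, z) \<in> le" using xy yz by (auto simp: le_iff)
    qed
  qed
  \<comment> \<open>The first component can be prolonged to any length \<open>m\<close>, even with masses prescribed on a
    larger set \<open>G\<close> as long as these cost at most \<open>2 * C\<close>.\<close>
  have extend: "\<exists>t. ((s, F), (t, F)) \<in> le \<and> length t = m
    \<and> (\<forall>n. length s \<le> n \<and> n < m \<longrightarrow> meets (length s) G n (t ! n))
      \<and> (\<forall>l\<in>set t. variation l \<le> 2 * C) \<and> (\<exists>u. t = s @ u)"
    if p: "(s, F) \<in> P" and m: "length s \<le> m" and FG: "F \<subseteq> G" and G: "finite G" "G \<subseteq> S"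
      "\<And>n. n \<ge> length s \<Longrightarrow> (\<Sum>\<xi>\<in>G. \<bar>h \<xi> n\<bar>) \<le> 2 * C" for s F G m
  proof -
    have "\<exists>l. variation l \<le> 2 * C \<and> meets (length s) G n l" if n: "n \<ge> length s" for n
    proof -
      obtain l where "variation l = (\<Sum>\<xi>\<in>G. \<bar>h \<xi> n\<bar>)" "\<And>\<xi>. \<xi> \<in> G \<Longrightarrow> mass l (A \<xi>) = h \<xi> n"
        "\<And>k c. (k, c) \<in> set l \<Longrightarrow> length s \<le> k"
        using prescribe_masses[OF G(1), of A "\<lambda>\<xi>. h \<xi> n" "length s"] inf ad G(2) by blast
      then show ?thesis using G(3)[OF n] by (intro exI[of _ l]) (auto simp: meets_def)
    qed
    then obtain l where l: "\<And>n. n \<ge> length s \<Longrightarrow> variation (l n) \<le> 2 * C"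
      "\<And>n. n \<ge> length s \<Longrightarrow> meets (length s) G n (l n)" by metis
    define t where "t = s @ map l [length s..<m]"
    have len: "length t = m" using m by (simp add: t_def)
    have tn: "t ! n = l n" if "length s \<le> n" "n < m" for n
      using that by (simp add: t_def nth_append)
    have meet: "meets (length s) G n (t ! n)" if "length s \<le> n" "n < m" for n
      using that l tn by simp
    have var: "\<forall>l\<in>set t. variation l \<le> 2 * C" using p l by (auto simp: t_def P_def)
    have "(t, F) \<in> P" using p m len ok_mono[of "length s" F m] var by (auto simp: P_def)
    moreover have "meets (length s) F n (t ! n)" if "length s \<le> n" "n < m" for n
      using meet[OF that] FG by (auto simp: meets_def)
    ultimately have "((s, F), (t, F)) \<in> le" using p len by (auto simp: le_iff t_def)
    then show ?thesis using len meet var by (auto simp: t_def)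
  qed
  have okD: "finite F" "F \<subseteq> S" "\<And>n. length s \<le> n \<Longrightarrow> (\<Sum>\<xi>\<in>F. \<bar>h \<xi> n\<bar>) \<le> C"
    if "(s, F) \<in> P" for s F
    using that by (auto simp: P_def ok_def)
  have C0: "0 \<le> C"
    using h[of "{}"] by simp
  have compatible: "\<exists>q\<in>P. ((s, F), q) \<in> le \<and> ((s, F'), q) \<in> le"
    if p: "(s, F) \<in> P" "(s, F') \<in> P" for s F F'
  proof -
    let ?G = "F \<union> F'"
    have G: "finite ?G" "?G \<subseteq> S" using okD p by auto
    obtain m where m: "m \<ge> length s" "ok m ?G" using ok_eventually[OF G] by blast
    have sum: "(\<Sum>\<xi>\<in>?G. \<bar>h \<xi> n\<bar>) \<le> 2 * C" if "n \<ge> length s" for n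
    proof -
      have "(\<Sum>\<xi>\<in>?G. \<bar>h \<xi> n\<bar>) \<le> (\<Sum>\<xi>\<in>F. \<bar>h \<xi> n\<bar>) + (\<Sum>\<xi>\<in>F'. \<bar>h \<xi> n\<bar>)"
        using okD[OF p(1)] okD[OF p(2)] by (subst sum.union_inter[symmetric]) (auto intro: sum_nonneg)
      then show ?thesis using okD(3)[OF p(1) that] okD(3)[OF p(2) that] by linarith
    qed
    obtain t where t: "length t = m" "\<And>n. length s \<le> n \<Longrightarrow> n < m \<Longrightarrow> meets (length s) ?G n (t ! n)"
      "\<forall>l\<in>set t. variation l \<le> 2 * C" "\<exists>u. t = s @ u"
      using extend[OF p(1) m(1) _ G sum] by blast
    have tP: "(t, ?G) \<in> P" using t m by (simp add: P_def)
    have "meets (length s) F n (t ! n) \<and> meets (length s) F' n (t ! n)" if "length s \<le> n" "n < m" for n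
      using t(2)[OF that] by (auto simp: meets_def)
    then show ?thesis using t p tP by (intro bexI[of _ "(t, ?G)"]) (auto simp: le_iff)
  qed
  have ccc: "ccc_poset P le"
    unfolding ccc_poset_def
  proof (intro allI impI)
    fix B assume B: "B \<subseteq> P" "uncountable B"
    have "\<not> inj_on fst B"
      using B(2) countableI_type[of "fst ` B"] countable_image_inj_on by blast
    then obtain p p' where pp: "p \<in> B" "p' \<in> B" "fst p = fst p'" "p \<noteq> p'" by (auto simp: inj_on_def)
    then have "\<exists>q\<in>P. (p, q) \<in> le \<and> (p', q) \<in> le"
      using compatible[of "fst p" "snd p" "snd p'"] B(1) by (metis prod.collapse subsetD)
    then show "\<exists>p\<in>B. \<exists>p'\<in>B. p \<noteq> p' \<and> (\<exists>q\<in>P. (p, q) \<in> le \<and> (p', q) \<in> le)"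
      using pp by blast
  qed
  have ne: "P \<noteq> {}"
  proof -
    have "([], {}) \<in> P" using C0 by (auto simp: P_def ok_def)
    then show ?thesis by blast
  qed
  \<comment> \<open>Both requirements on the filter, that every \<open>\<xi> \<in> S\<close> gets promised and that the segments
    become arbitrarily long, are coded into one family of dense sets indexed by \<open>Field \<kappa>\<close>.\<close>
  obtain j :: "'s \<Rightarrow> nat" where j: "j ` S = UNIV"
  proof -
    obtain e :: "nat \<Rightarrow> 's" where "inj e" "range e \<subseteq> S" using S infinite_countable_subset by blast
    then have "k \<in> inv e ` S" for k by (intro image_eqI[of _ _ "e k"]) auto
    then have "inv e ` S = UNIV" by blast
    then show ?thesis using that by blast
  qed
  obtain g :: "'c \<Rightarrow> 's" where g: "g ` Field \<kappa> = S"
  proof -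
    have "|S| \<le>o |Field \<kappa>|" using card \<kappa> card_of_Field_ordIso ordIso_symmetric ordLeq_ordIso_trans by blast
    then obtain f where f: "inj_on f S" "f ` S \<subseteq> Field \<kappa>" by (auto simp flip: card_of_ordLeq)
    obtain \<xi>0 where "\<xi>0 \<in> S" using S by fastforce
    have "(\<lambda>x. if x \<in> f ` S then inv_into S f x else \<xi>0) ` Field \<kappa> = S"
    proof
      show "S \<subseteq> (\<lambda>x. if x \<in> f ` S then inv_into S f x else \<xi>0) ` Field \<kappa>"
      proof
        fix \<xi> assume "\<xi> \<in> S"
        then show "\<xi> \<in> (\<lambda>x. if x \<in> f ` S then inv_into S f x else \<xi>0) ` Field \<kappa>"
          using f by (intro image_eqI[of _ _ "f \<xi>"]) auto
      qed
    qed (use \<open>\<xi>0 \<in> S\<close> inv_into_into[of _ f S] in auto)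
    then show ?thesis by (rule that)
  qed
  define D where "D x = {(s, F) \<in> P. g x \<in> F \<and> j (g x) \<le> length s}" for x
  have dense: "dense_in_poset P le (D x)" if x: "x \<in> Field \<kappa>" for x
    unfolding dense_in_poset_def
  proof (intro conjI ballI)
    show "D x \<subseteq> P" by (auto simp: D_def)
    fix p assume "p \<in> P"
    then obtain s F where p: "p = (s, F)" "(s, F) \<in> P" by (metis surj_pair)
    have gx: "g x \<in> S" using g x by blast
    obtain m where m: "m \<ge> max (length s) (j (g x))" "ok m (insert (g x) F)"
      using ok_eventually[of "insert (g x) F"] okD[OF p(2)] gx by blast
    have "(\<Sum>\<xi>\<in>F. \<bar>h \<xi> n\<bar>) \<le> 2 * C" if "length s \<le> n" for n
      using okD(3)[OF p(2) that] C0 by linarith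
    then obtain t where t: "((s, F), (t, F)) \<in> le" "length t = m" "\<forall>l\<in>set t. variation l \<le> 2 * C"
      using extend[OF p(2), of m F] okD[OF p(2)] m by auto
    have "(t, insert (g x) F) \<in> D x" using t m by (auto simp: D_def P_def)
    moreover have "((s, F), (t, insert (g x) F)) \<in> le" using t calculation by (auto simp: le_iff D_def)
    ultimately show "\<exists>d\<in>D x. (p, d) \<in> le" using p by blast
  qed
  obtain G where G: "G \<subseteq> P" "directed_in_poset le G" "\<And>x. x \<in> Field \<kappa> \<Longrightarrow> G \<inter> D x \<noteq> {}"
    using martins_axiom_imp_on[OF ma, unfolded martins_axiom_on_def, rule_format, of P le D] ne po ccc dense
    by blast
  have G_hit: "\<exists>s F. (s, F) \<in> G \<and> \<xi> \<in> F \<and> j \<xi> \<le> length s" if \<xi>: "\<xi> \<in> S" for \<xi>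
  proof -
    obtain x where "x \<in> Field \<kappa>" "g x = \<xi>" using \<xi> g by blast
    then show ?thesis using G(3)[of x] by (auto simp: D_def)
  qed
  have coherent: "s ! n = t ! n"
    if s: "(s, F) \<in> G" "n < length s" and t: "(t, H) \<in> G" "n < length t" for s F t H n
  proof -
    obtain q where q: "q \<in> G" "((s, F), q) \<in> le" "((t, H), q) \<in> le"
      using G(2) s(1) t(1) unfolding directed_in_poset_def by blast
    obtain w W where w: "q = (w, W)" by fastforce
    obtain u u' where u: "w = s @ u" "w = t @ u'" using q by (auto simp: w le_iff)
    have "w ! n = s ! n" unfolding u(1) using s by (simp add: nth_append)
    moreover have "w ! n = t ! n" unfolding u(2) using t by (simp add: nth_append)
    ultimately show ?thesis by simp
  qed
  have long: "\<exists>s F. (s, F) \<in> G \<and> n < length s" for n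
  proof -
    obtain \<xi> where "\<xi> \<in> S" "j \<xi> = Suc n" using j by (metis UNIV_I imageE)
    then obtain s F where "(s, F) \<in> G" "Suc n \<le> length s" using G_hit[of \<xi>] by auto
    then show ?thesis using Suc_le_lessD by blast
  qed
  define \<mu> where "\<mu> n = (SOME l. \<exists>s F. (s, F) \<in> G \<and> n < length s \<and> l = s ! n)" for n
  have \<mu>: "\<mu> n = s ! n" if s: "(s, F) \<in> G" "n < length s" for s F n
  proof -
    have "\<exists>l. \<exists>s F. (s, F) \<in> G \<and> n < length s \<and> l = s ! n" using s by blast
    from someI_ex[OF this] obtain t H where "(t, H) \<in> G" "n < length t" "\<mu> n = t ! n"
      unfolding \<mu>_def by blast
    then show ?thesis using coherent[OF s] by simp
  qed
  have \<mu>_meets: "meets (length s) F n (\<mu> n)" if s: "(s, F) \<in> G" "length s \<le> n" for s F n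
  proof -
    obtain t H where t: "(t, H) \<in> G" "n < length t" using long by blast
    obtain q where q: "q \<in> G" "((s, F), q) \<in> le" "((t, H), q) \<in> le"
      using G(2) s t unfolding directed_in_poset_def by blast
    obtain w W where w: "q = (w, W)" by fastforce
    have "n < length w" using q(3) t by (auto simp: w le_iff)
    then have "meets (length s) F n (w ! n)" using q(2) s by (auto simp: w le_iff)
    then show ?thesis using \<mu>[of w W n] q(1) w \<open>n < length w\<close> by simp
  qed
  show ?thesis
  proof (rule that)
    show "variation (\<mu> n) \<le> 2 * C" for n
    proof -
      obtain s F where s: "(s, F) \<in> G" "n < length s" using long by blast
      then have "s ! n \<in> set s" "(s, F) \<in> P" using G(1) by auto
      then show ?thesis using \<mu>[OF s] by (auto simp: P_def)
    qed
    show "\<forall>\<^sub>F n in sequentially. k \<notin> fst ` set (\<mu> n)" for k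
    proof -
      obtain s F where s: "(s, F) \<in> G" "k < length s" using long by blast
      have "k \<notin> fst ` set (\<mu> n)" if "n \<ge> length s" for n
        using \<mu>_meets[OF s(1) that] s(2) unfolding meets_def by (metis leD)
      then show ?thesis unfolding eventually_sequentially by blast
    qed
    show "\<forall>\<^sub>F n in sequentially. mass (\<mu> n) (A \<xi>) = h \<xi> n" if \<xi>: "\<xi> \<in> S" for \<xi>
    proof -
      obtain s F where s: "(s, F) \<in> G" "\<xi> \<in> F" using G_hit[OF \<xi>] by blast
      have "mass (\<mu> n) (A \<xi>) = h \<xi> n" if "n \<ge> length s" for n
        using \<mu>_meets[OF s(1) that] s(2) by (simp add: meets_def)
      then show ?thesis unfolding eventually_sequentially by blast
    qed
  qed
qed

section \<open>Null sequences of functionals and splitting\<close>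

lemma c0_seq_le_norm: "\<bar>apply_bcontfun (c0_seq z) n\<bar> \<le> norm z"
  using norm_bounded[of "c0_seq z" n] by (simp add: norm_c0_def)

lemma abs_le_of_linear_le:
  fixes l :: "'v::real_normed_vector \<Rightarrow> real"
  assumes "linear l" "\<And>x. l x \<le> B * norm x"
  shows "\<bar>l x\<bar> \<le> B * norm x"
  using assms(2)[of x] assms(2)[of "- x"] linear_neg[OF assms(1), of x] by simp

text \<open>The coordinate functionals of \<open>c0\<close>, transported to the range of \<open>i\<close>, are uniformly bounded
  by the open mapping theorem, and so are their Hahn-Banach extensions.\<close>

lemma coordinate_extensions:
  fixes i :: "c0 \<Rightarrow> 'x::banach"
  assumes i: "bounded_linear i" "inj i" "closed (range i)"
  obtains f :: "nat \<Rightarrow> 'x \<Rightarrow> real" and B where "B > 0" "\<And>n. linear (f n)" "\<And>n x. \<bar>f n x\<bar> \<le> B * norm x"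
    "\<And>n z. f n (i z) = apply_bcontfun (c0_seq z) n"
proof -
  obtain B where B: "B > 0" "\<And>y. y \<in> range i \<Longrightarrow> \<exists>z. i z = y \<and> norm z \<le> B * norm y"
    using open_mapping[OF i(1,3)] by blast
  have norm_le: "norm z \<le> B * norm (i z)" for z
    using B(2)[of "i z"] i(2) by (metis injD rangeI)
  have sub: "sublinear (\<lambda>x::'x. B * norm x)"
    using B(1) by (auto simp: sublinear_def norm_triangle_ineq simp flip: distrib_left)
  have "\<exists>l. linear l \<and> (\<forall>x. l x \<le> B * norm x) \<and> (\<forall>z. l (i z) = apply_bcontfun (c0_seq z) n)" for n
  proof -
    have lin: "linear (\<lambda>z. apply_bcontfun (c0_seq z) n)" by (intro linearI) (auto simp: c0_seq_simps)
    have "apply_bcontfun (c0_seq z) n \<le> B * norm (i z)" for z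
      using c0_seq_le_norm[of z n] norm_le[of z] by linarith
    then show ?thesis
      using hahn_banach[OF sub bounded_linear.linear[OF i(1)] lin] by metis
  qed
  then obtain f where f: "\<And>n. linear (f n)" "\<And>n x. f n x \<le> B * norm x"
    "\<And>n z. f n (i z) = apply_bcontfun (c0_seq z) n" by metis
  then show ?thesis using that[OF B(1)] abs_le_of_linear_le by blast
qed

text \<open>Convergence to 0 of a bounded sequence of functionals holds on a closed subspace. The open
  mapping constant \<open>M\<close> turns density in the quotient into density modulo the kernel of \<open>q\<close>.\<close>

lemma null_everywhere:
  fixes q :: "'x::real_normed_vector \<Rightarrow> 'y::real_normed_vector" and D :: "nat \<Rightarrow> 'x \<Rightarrow> real"
  assumes q: "linear q" and M: "M > 0" "\<And>y. \<exists>x. q x = y \<and> norm x \<le> M * norm y"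
    and D: "\<And>n. linear (D n)" "\<And>n x. \<bar>D n x\<bar> \<le> B * norm x"
    and ker: "\<And>x. q x = 0 \<Longrightarrow> (\<lambda>n. D n x) \<longlonglongrightarrow> 0"
    and G: "\<And>x. x \<in> G \<Longrightarrow> (\<lambda>n. D n x) \<longlonglongrightarrow> 0"
    and dense: "closure (span (q ` G)) = UNIV"
  shows "(\<lambda>n. D n x) \<longlonglongrightarrow> 0"
proof (rule LIMSEQ_I)
  fix \<epsilon> :: real assume \<epsilon>: "\<epsilon> > 0"
  have span: "(\<lambda>n. D n w) \<longlonglongrightarrow> 0" if "w \<in> span G" for w
    using that
  proof (induction rule: span_induct_alt)
    case base
    then show ?case by (simp add: linear_0[OF D(1)])
  next
    case (step c x y)
    then show ?case
      using tendsto_add[OF tendsto_mult_right_zero[OF G[OF step(1)], of c] step(2)]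
      by (simp add: linear_add[OF D(1)] linear_cmul[OF D(1)])
  qed
  define \<delta> where "\<delta> = \<epsilon> / (2 * (\<bar>B\<bar> * M + 1))"
  have pos: "\<bar>B\<bar> * M + 1 > 0" using M(1) by (simp add: add_nonneg_pos)
  have \<delta>: "\<delta> > 0" "(\<bar>B\<bar> * M + 1) * \<delta> = \<epsilon> / 2" using \<epsilon> pos by (auto simp: \<delta>_def field_simps)
  obtain y where "y \<in> span (q ` G)" "dist y (q x) < \<delta>"
    using dense \<delta>(1) closure_approachable[of "q x" "span (q ` G)"] by auto
  then obtain w where w: "w \<in> span G" "dist (q w) (q x) < \<delta>"
    using linear_span_image[OF q, of G] by auto
  obtain v where v: "q v = q x - q w" "norm v \<le> M * norm (q x - q w)" using M(2) by blast
  define k where "k = x - w - v"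
  have "q k = 0" using v by (simp add: k_def linear_diff[OF q])
  have "norm (q x - q w) \<le> \<delta>" using w(2) by (simp add: dist_norm norm_minus_commute)
  have "M * norm (q x - q w) \<le> M * \<delta>" using \<open>norm (q x - q w) \<le> \<delta>\<close> M(1) by (intro mult_left_mono) auto
  then have nv: "norm v \<le> M * \<delta>" using v(2) by linarith
  have Dv: "\<bar>D n v\<bar> \<le> \<epsilon> / 2" for n
  proof -
    have "\<bar>D n v\<bar> \<le> \<bar>B\<bar> * norm v"
      using D(2)[of n v] mult_right_mono[OF abs_ge_self[of B] norm_ge_zero[of v]] by linarith
    also have "\<dots> \<le> \<bar>B\<bar> * (M * \<delta>)" by (intro mult_left_mono nv) simp
    also have "\<dots> \<le> \<epsilon> / 2" using \<delta> by (simp add: algebra_simps)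
    finally show ?thesis .
  qed
  have "(\<lambda>n. D n w + D n k) \<longlonglongrightarrow> 0"
    using tendsto_add[OF span[OF w(1)] ker[OF \<open>q k = 0\<close>]] by simp
  then obtain N where N: "\<And>n. n \<ge> N \<Longrightarrow> \<bar>D n w + D n k\<bar> < \<epsilon> / 2"
    using LIMSEQ_D[of _ 0 "\<epsilon> / 2"] \<epsilon> by fastforce
  have "D n x = D n v + (D n w + D n k)" for n
    by (simp add: k_def linear_diff[OF D(1)])
  then show "\<exists>N. \<forall>n\<ge>N. norm (D n x - 0) < \<epsilon>"
    using N Dv by (intro exI[of _ N]) (smt (verit) field_sum_of_halves real_norm_def)
qed

text \<open>A left inverse of \<open>i\<close> is the same as a bounded, pointwise null sequence of functionals that
  extends the coordinate functionals.\<close>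

lemma trivial_twisted_sumI:
  fixes i :: "c0 \<Rightarrow> 'x::banach" and q :: "'x \<Rightarrow> 'y::banach" and D :: "nat \<Rightarrow> 'x \<Rightarrow> real"
  assumes tw: "twisted_sum i q" and D: "\<And>n. linear (D n)" "\<And>n x. \<bar>D n x\<bar> \<le> B * norm x"
    and Di: "\<And>n z. D n (i z) = apply_bcontfun (c0_seq z) n"
    and null: "\<And>x. (\<lambda>n. D n x) \<longlonglongrightarrow> 0"
  shows "trivial_twisted_sum i q"
proof -
  define r where "r x = Abs_c0 (Bcontfun (\<lambda>n. D n x))" for x
  have bc: "(\<lambda>n. D n x) \<in> bcontfun" for x
    by (rule bcontfun_normI[of _ "B * norm x"]) (use D(2) in auto)
  have r: "apply_bcontfun (c0_seq (r x)) n = D n x" for x n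
    using null by (simp add: r_def Abs_c0_inverse Bcontfun_inverse bc)
  have eqI: "u = v" if "\<And>n. apply_bcontfun (c0_seq u) n = apply_bcontfun (c0_seq v) n" for u v
    using that by (intro c0_eqI bcontfun_eqI)
  have "bounded_linear r"
  proof (rule bounded_linear_intro[of _ B])
    show "r (x + y) = r x + r y" for x y by (rule eqI) (simp add: r c0_seq_simps linear_add[OF D(1)])
    show "r (c *\<^sub>R x) = c *\<^sub>R r x" for c x by (rule eqI) (simp add: r c0_seq_simps linear_cmul[OF D(1)])
    show "norm (r x) \<le> norm x * B" for x
      unfolding norm_c0_def by (rule norm_bound) (use D(2) in \<open>simp add: r mult.commute\<close>)
  qed
  moreover have "r (i z) = z" for z by (rule eqI) (simp add: r Di)
  ultimately show ?thesis using tw unfolding trivial_twisted_sum_def by blast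
qed

text \<open>A bounded sequence of functionals that is null on the kernel of \<open>q\<close> acts, in the limit, as a
  single operator from the quotient into \<open>\<ell>\<^sub>\<infinity>/c\<^sub>0\<close>. A family in the quotient all of whose signed
  sums lie in the unit ball therefore has asymptotically absolutely summable values, with a bound
  that does not depend on the size of the family: lift each signed sum with the constant \<open>M\<close>, and
  choose the signs of the values.\<close>

lemma eventually_sum_abs_le:
  fixes q :: "'x::real_normed_vector \<Rightarrow> 'y::real_normed_vector" and D :: "nat \<Rightarrow> 'x \<Rightarrow> real"
  assumes q: "linear q" and M: "M > 0" "\<And>y. \<exists>x. q x = y \<and> norm x \<le> M * norm y"
    and D: "\<And>n. linear (D n)" "\<And>n x. \<bar>D n x\<bar> \<le> B * norm x" and B: "B \<ge> 0"
    and ker: "\<And>x. q x = 0 \<Longrightarrow> (\<lambda>n. D n x) \<longlonglongrightarrow> 0"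
    and F: "finite F"
    and small: "\<And>\<sigma>. (\<And>\<xi>. \<xi> \<in> F \<Longrightarrow> \<bar>\<sigma> \<xi>\<bar> \<le> 1) \<Longrightarrow> norm (\<Sum>\<xi>\<in>F. \<sigma> \<xi> *\<^sub>R q (x \<xi>)) \<le> 1"
  shows "\<forall>\<^sub>F n in sequentially. (\<Sum>\<xi>\<in>F. \<bar>D n (x \<xi>)\<bar>) \<le> B * M + 1"
proof -
  define \<Sigma> where "\<Sigma> = F \<rightarrow>\<^sub>E {-1, 1::real}"
  have "\<forall>\<^sub>F n in sequentially. D n (\<Sum>\<xi>\<in>F. \<sigma> \<xi> *\<^sub>R x \<xi>) \<le> B * M + 1" if \<sigma>: "\<sigma> \<in> \<Sigma>" for \<sigma>
  proof -
    let ?x = "\<Sum>\<xi>\<in>F. \<sigma> \<xi> *\<^sub>R x \<xi>"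
    have "\<bar>\<sigma> \<xi>\<bar> \<le> 1" if "\<xi> \<in> F" for \<xi> using PiE_mem[OF \<sigma>[unfolded \<Sigma>_def] that] by auto
    then have "norm (q ?x) \<le> 1" using small[of \<sigma>] by (simp add: linear_sum[OF q] linear_cmul[OF q])
    obtain w where w: "q w = q ?x" "norm w \<le> M * norm (q ?x)" using M(2) by blast
    have "M * norm (q ?x) \<le> M * 1" using M(1) \<open>norm (q ?x) \<le> 1\<close> by (intro mult_left_mono) auto
    then have "B * norm w \<le> B * M" using w(2) B by (intro mult_left_mono) auto
    then have Dw: "\<bar>D n w\<bar> \<le> B * M" for n using D(2)[of n w] by linarith
    have "(\<lambda>n. D n (?x - w)) \<longlonglongrightarrow> 0" by (rule ker) (simp add: linear_diff[OF q] w)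
    then have "\<forall>\<^sub>F n in sequentially. D n (?x - w) < 1" by (rule order_tendstoD) simp
    then show ?thesis
    proof eventually_elim
      case (elim n)
      then show ?case using Dw[of n] by (simp add: linear_diff[OF D(1)])
    qed
  qed
  moreover have "finite \<Sigma>" unfolding \<Sigma>_def using F by (intro finite_PiE) auto
  ultimately have "\<forall>\<^sub>F n in sequentially. \<forall>\<sigma>\<in>\<Sigma>. D n (\<Sum>\<xi>\<in>F. \<sigma> \<xi> *\<^sub>R x \<xi>) \<le> B * M + 1"
    by (simp add: eventually_ball_finite)
  then show ?thesis
  proof eventually_elim
    case (elim n)
    define \<sigma> where "\<sigma> = (\<lambda>\<xi>\<in>F. if D n (x \<xi>) \<ge> 0 then 1 else (-1::real))"
    have "\<sigma> \<in> \<Sigma>" by (auto simp: \<sigma>_def \<Sigma>_def)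
    have "(\<Sum>\<xi>\<in>F. \<bar>D n (x \<xi>)\<bar>) = (\<Sum>\<xi>\<in>F. \<sigma> \<xi> * D n (x \<xi>))"
      by (rule sum.cong) (auto simp: \<sigma>_def)
    also have "\<dots> = D n (\<Sum>\<xi>\<in>F. \<sigma> \<xi> *\<^sub>R x \<xi>)"
      by (simp add: linear_sum[OF D(1)] linear_cmul[OF D(1)])
    finally show ?case using elim \<open>\<sigma> \<in> \<Sigma>\<close> by auto
  qed
qed

text \<open>The point of truncation may move to infinity as slowly as the eventual bounds require: take
  the largest admissible \<open>j \<le> n\<close>.\<close>

lemma diagonal_truncation:
  fixes t :: "nat \<Rightarrow> nat \<Rightarrow> real"
  assumes t: "\<And>j. \<forall>\<^sub>F n in sequentially. (\<Sum>k<j. \<bar>t n k\<bar>) \<le> C"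
  obtains J :: "nat \<Rightarrow> nat" where "\<And>n. (\<Sum>k<J n. \<bar>t n k\<bar>) \<le> C" "\<And>k. \<forall>\<^sub>F n in sequentially. k < J n"
proof -
  have C: "0 \<le> C" using t[of 0] by simp
  \<comment> \<open>The bound \<open>j \<le> n\<close> only serves to make the maximum exist.\<close>
  define A where "A n = {j. j \<le> n \<and> (\<Sum>k<j. \<bar>t n k\<bar>) \<le> C}" for n
  have A: "finite (A n)" "0 \<in> A n" for n using C by (auto simp: A_def)
  show ?thesis
  proof (rule that[of "\<lambda>n. Max (A n)"])
    show "(\<Sum>k<Max (A n). \<bar>t n k\<bar>) \<le> C" for n
    proof -
      have "Max (A n) \<in> A n" using Max_in[OF A(1)] A(2) by blast
      then show ?thesis by (simp add: A_def)
    qed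
    show "\<forall>\<^sub>F n in sequentially. k < Max (A n)" for k
      using t[of "Suc k"] eventually_ge_at_top[of "Suc k"]
    proof eventually_elim
      case (elim n)
      then have "Suc k \<in> A n" by (simp add: A_def)
      then show ?case using Max_ge[OF A(1)] by (simp add: Suc_le_lessD)
    qed
  qed
qed

lemma rational_approximation:
  fixes h :: "'s \<Rightarrow> nat \<Rightarrow> real"
  obtains \<rho> :: "'s \<Rightarrow> nat \<Rightarrow> rat" where "\<And>\<xi> n. \<bar>h \<xi> n - of_rat (\<rho> \<xi> n)\<bar> \<le> inverse (real (Suc n))"
proof -
  have "\<exists>r. \<bar>h \<xi> n - of_rat r\<bar> \<le> inverse (real (Suc n))" for \<xi> n
  proof -
    obtain r where "h \<xi> n < of_rat r" "of_rat r < h \<xi> n + inverse (real (Suc n))"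
      using of_rat_dense[of "h \<xi> n" "h \<xi> n + inverse (real (Suc n))"] by auto
    then show ?thesis by (intro exI[of _ r]) auto
  qed
  then show ?thesis using that by metis
qed

section \<open>Correcting the functionals on the three kinds of points\<close>

text \<open>On the span of the countably many isolated points the functionals can be corrected without
  any axiom, as in Sobczyk's theorem: the values of \<open>D n\<close> on lifts of the first \<open>J n\<close> indicators
  form a measure, and these measures are uniformly bounded when \<open>J n\<close> grows slowly enough.\<close>

lemma isolated_point_correction:
  fixes q :: "'x::real_normed_vector \<Rightarrow> ('k::t1_space \<Rightarrow>\<^sub>C real)" and D :: "nat \<Rightarrow> 'x \<Rightarrow> real"
    and e :: "nat \<Rightarrow> 'k"
  assumes q: "linear q" and M: "M > 0" "\<And>y. \<exists>x. q x = y \<and> norm x \<le> M * norm y"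
    and D: "\<And>n. linear (D n)" "\<And>n x. \<bar>D n x\<bar> \<le> B * norm x" and B: "B \<ge> 0"
    and ker: "\<And>x. q x = 0 \<Longrightarrow> (\<lambda>n. D n x) \<longlonglongrightarrow> 0"
    and e: "inj e" "\<And>k. open {e k}"
  obtains a :: "nat \<Rightarrow> ('k \<Rightarrow>\<^sub>C real) \<Rightarrow> real" and C
  where "\<And>n. linear (a n)" "\<And>n g. \<bar>a n g\<bar> \<le> C * norm g"
    "\<And>x k. q x = clopen_indicator {e k} \<Longrightarrow> (\<lambda>n. D n x - a n (q x)) \<longlonglongrightarrow> 0"
proof -
  have "\<forall>k. \<exists>v. q v = clopen_indicator {e k}" using M(2) by blast
  then obtain x where x: "\<And>k. q (x k) = clopen_indicator {e k}" by metis
  define t where "t n k = D n (x k)" for n k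
  have small: "norm (\<Sum>k<j. \<sigma> k *\<^sub>R q (x k)) \<le> 1" if "\<And>k. k \<in> {..<j} \<Longrightarrow> \<bar>\<sigma> k\<bar> \<le> 1" for \<sigma> and j :: nat
    unfolding x by (rule norm_sum_disjoint_indicators_le) (use e that in \<open>auto dest: injD\<close>)
  have "\<forall>\<^sub>F n in sequentially. (\<Sum>k<j. \<bar>t n k\<bar>) \<le> B * M + 1" for j
    unfolding t_def by (rule eventually_sum_abs_le[OF q M D B ker finite_lessThan small])
  then obtain J where J: "\<And>n. (\<Sum>k<J n. \<bar>t n k\<bar>) \<le> B * M + 1" "\<And>k. \<forall>\<^sub>F n in sequentially. k < J n"
    using diagonal_truncation by metis
  define a where "a n g = (\<Sum>k<J n. t n k * apply_bcontfun g (e k))" for n and g :: "'k \<Rightarrow>\<^sub>C real"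
  show ?thesis
  proof (rule that)
    show "linear (a n)" for n
      by (rule linearI) (simp_all add: a_def sum.distrib sum_distrib_left algebra_simps)
    show "\<bar>a n g\<bar> \<le> (B * M + 1) * norm g" for n g
    proof -
      have "\<bar>a n g\<bar> \<le> (\<Sum>k<J n. \<bar>t n k\<bar> * norm g)"
        unfolding a_def using norm_bounded[of g]
        by (intro order_trans[OF sum_abs] sum_mono) (auto simp: abs_mult intro: mult_left_mono)
      also have "\<dots> = (\<Sum>k<J n. \<bar>t n k\<bar>) * norm g" by (simp add: sum_distrib_right)
      also have "\<dots> \<le> (B * M + 1) * norm g" by (rule mult_right_mono[OF J(1)]) simp
      finally show ?thesis .
    qed
    fix y k assume y: "q y = clopen_indicator {e k}"
    have "\<forall>\<^sub>F n in sequentially. D n (y - x k) = D n y - a n (q y)"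
      using J(2)[of k]
    proof eventually_elim
      case (elim n)
      have "a n (q y) = (\<Sum>k'<J n. if k' = k then t n k' else 0)"
        unfolding a_def y by (rule sum.cong)
          (use e in \<open>auto simp: clopen_indicator_apply indicator_def dest: injD\<close>)
      then show ?case using elim by (simp add: linear_diff[OF D(1)] t_def)
    qed
    moreover have "(\<lambda>n. D n (y - x k)) \<longlonglongrightarrow> 0"
      by (rule ker) (simp add: linear_diff[OF q] x y)
    ultimately show "(\<lambda>n. D n y - a n (q y)) \<longlonglongrightarrow> 0" by (rule Lim_transform_eventually[rotated])
  qed
qed

lemma clopen_Int_finite:
  fixes U V :: "'k::t2_space set"
  assumes K: "compact (UNIV :: 'k set)" and "closed U" "closed V" and "U \<inter> V \<inter> derived UNIV = {}"
  shows "finite (U \<inter> V)"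
proof (rule compact_disjoint_derived_finite)
  show "compact (U \<inter> V)" using assms compact_Int_closed[OF K, of "U \<inter> V"] by auto
  have "derived (U \<inter> V) \<subseteq> derived UNIV" by (rule derived_mono) simp
  then show "U \<inter> V \<inter> derived (U \<inter> V) = {}" using assms(4) by blast
qed

text \<open>Here \<open>D\<close> is already null on the lifts of indicators of isolated points. Consequently the
  values on the indicators of the \<open>U \<xi>\<close> do not change, up to a null sequence, when finitely many
  isolated points are removed from the \<open>U \<xi>\<close>. Finitely many \<open>U \<xi>\<close> thus become disjoint, so their
  values have bounded sums. This is the hypothesis under which Martin's axiom provides measures
  \<open>\<mu> n\<close> on the isolated points with the given masses on the traces of the \<open>U \<xi>\<close>, which form an
  almost disjoint family. As the \<open>\<mu> n\<close> eventually avoid each isolated point, subtracting them does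
  not spoil what was achieved there.\<close>

lemma martin_correction:
  fixes q :: "'x::real_normed_vector \<Rightarrow> ('k::t2_space \<Rightarrow>\<^sub>C real)" and D :: "nat \<Rightarrow> 'x \<Rightarrow> real"
    and e :: "nat \<Rightarrow> 'k"
    and \<kappa> :: "'c rel" and U :: "'k \<Rightarrow> 'k set"
  assumes ma: "martins_axiom \<kappa>" "Card_order \<kappa>" "|S| \<le>o \<kappa>" "infinite S"
    and K: "compact (UNIV :: 'k set)"
    and U: "\<And>\<xi>. \<xi> \<in> S \<Longrightarrow> open (U \<xi>) \<and> closed (U \<xi>) \<and> U \<xi> \<inter> derived UNIV = {\<xi>}"
    and q: "linear q" and M: "M > 0" "\<And>y. \<exists>x. q x = y \<and> norm x \<le> M * norm y"
    and D: "\<And>n. linear (D n)" "\<And>n x. \<bar>D n x\<bar> \<le> B * norm x" and B: "B \<ge> 0"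
    and ker: "\<And>x. q x = 0 \<Longrightarrow> (\<lambda>n. D n x) \<longlonglongrightarrow> 0"
    and e: "inj e" "range e = - derived UNIV"
    and iso: "\<And>x k. q x = clopen_indicator {e k} \<Longrightarrow> (\<lambda>n. D n x) \<longlonglongrightarrow> 0"
  obtains c :: "nat \<Rightarrow> ('k \<Rightarrow>\<^sub>C real) \<Rightarrow> real" and C
  where "\<And>n. linear (c n)" "\<And>n g. \<bar>c n g\<bar> \<le> C * norm g"
    "\<And>x k. q x = clopen_indicator {e k} \<Longrightarrow> (\<lambda>n. D n x - c n (q x)) \<longlonglongrightarrow> 0"
    "\<And>x \<xi>. \<xi> \<in> S \<Longrightarrow> q x = clopen_indicator (U \<xi>) \<Longrightarrow> (\<lambda>n. D n x - c n (q x)) \<longlonglongrightarrow> 0"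
proof -
  have open_e: "open {e k}" for k using e(2) derived_UNIV[of "e k"] by blast
  have U_open: "open (U \<xi>)" and U_closed: "closed (U \<xi>)" and U_K1: "U \<xi> \<inter> derived UNIV = {\<xi>}"
    if "\<xi> \<in> S" for \<xi> using U[OF that] by auto
  define L where "L g = (SOME v. q v = g)" for g
  have L: "q (L g) = g" for g
    unfolding L_def by (rule someI_ex) (use M(2)[of g] in blast)
  define h where "h \<xi> n = D n (L (clopen_indicator (U \<xi>)))" for \<xi> n
  have finInt: "finite (U \<xi> \<inter> U \<eta>)" and disjInt: "U \<xi> \<inter> U \<eta> \<inter> derived UNIV = {}"
    if "\<xi> \<in> S" "\<eta> \<in> S" "\<xi> \<noteq> \<eta>" for \<xi> \<eta>
  proof -
    have "U \<xi> \<inter> U \<eta> \<inter> derived UNIV = (U \<xi> \<inter> derived UNIV) \<inter> (U \<eta> \<inter> derived UNIV)" by blast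
    also have "\<dots> = {}" unfolding U_K1[OF that(1)] U_K1[OF that(2)] using that(3) by simp
    finally show disj: "U \<xi> \<inter> U \<eta> \<inter> derived UNIV = {}" .
    show "finite (U \<xi> \<inter> U \<eta>)"
      by (rule clopen_Int_finite[OF K U_closed[OF that(1)] U_closed[OF that(2)] disj])
  qed
  have h_bound: "\<forall>\<^sub>F n in sequentially. (\<Sum>\<xi>\<in>F. \<bar>h \<xi> n\<bar>) \<le> B * M + 2" if F: "finite F" "F \<subseteq> S" for F
  proof -
    \<comment> \<open>The overlaps of the \<open>U \<xi>\<close>: a finite clopen set of isolated points.\<close>
    define E where "E = (\<Union>\<xi>\<in>F. \<Union>\<eta>\<in>F - {\<xi>}. U \<xi> \<inter> U \<eta>)"
    have E_fin: "finite E" unfolding E_def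
    proof (intro finite_UN_I)
      show "finite (U \<xi> \<inter> U \<eta>)" if "\<xi> \<in> F" "\<eta> \<in> F - {\<xi>}" for \<xi> \<eta>
        by (rule finInt) (use F that in auto)
    qed (use F in auto)
    have E_disj: "E \<inter> derived UNIV = {}"
    proof -
      have "U \<xi> \<inter> U \<eta> \<inter> derived UNIV = {}" if "\<xi> \<in> F" "\<eta> \<in> F - {\<xi>}" for \<xi> \<eta>
        by (rule disjInt) (use F that in auto)
      then show ?thesis unfolding E_def by blast
    qed
    then have E_open: "open E" using derived_UNIV open_UN[of E "\<lambda>d. {d}"] by auto
    define V where "V \<xi> = U \<xi> - E" for \<xi>
    have V: "open (V \<xi>)" "closed (V \<xi>)" if "\<xi> \<in> F" for \<xi>
      using U_open U_closed F(2) that E_open finite_imp_closed[OF E_fin] by (auto simp: V_def)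
    define y where "y \<xi> = L (clopen_indicator (U \<xi>)) - L (clopen_indicator (V \<xi>))" for \<xi>
    have small: "norm (\<Sum>\<xi>\<in>F. \<sigma> \<xi> *\<^sub>R q (L (clopen_indicator (V \<xi>)))) \<le> 1"
      if "\<And>\<xi>. \<xi> \<in> F \<Longrightarrow> \<bar>\<sigma> \<xi>\<bar> \<le> 1" for \<sigma>
      unfolding L
    proof (rule norm_sum_disjoint_indicators_le[OF F(1)])
      show "open (V \<xi>) \<and> closed (V \<xi>)" if "\<xi> \<in> F" for \<xi> using V[OF that] by simp
      show "V \<xi> \<inter> V \<eta> = {}" if "\<xi> \<in> F" "\<eta> \<in> F" "\<xi> \<noteq> \<eta>" for \<xi> \<eta>
        using that unfolding V_def E_def by blast
    qed (rule that)
    have V_bound: "\<forall>\<^sub>F n in sequentially. (\<Sum>\<xi>\<in>F. \<bar>D n (L (clopen_indicator (V \<xi>)))\<bar>) \<le> B * M + 1"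
      by (rule eventually_sum_abs_le[OF q M D B ker F(1) small])
    have y_null: "(\<lambda>n. D n (y \<xi>)) \<longlonglongrightarrow> 0" if \<xi>: "\<xi> \<in> F" for \<xi>
    proof -
      let ?w = "\<Sum>d\<in>U \<xi> \<inter> E. L (clopen_indicator {d})"
      have "(\<lambda>n. \<Sum>d\<in>U \<xi> \<inter> E. D n (L (clopen_indicator {d}))) \<longlonglongrightarrow> (\<Sum>d\<in>U \<xi> \<inter> E. 0)"
      proof (rule tendsto_sum)
        fix d assume "d \<in> U \<xi> \<inter> E"
        then have "d \<in> range e" using E_disj e(2) by blast
        then obtain k where "d = e k" by blast
        then show "(\<lambda>n. D n (L (clopen_indicator {d}))) \<longlonglongrightarrow> 0" using iso[of _ k] L by simp
      qed
      then have 1: "(\<lambda>n. D n ?w) \<longlonglongrightarrow> 0" by (simp add: linear_sum[OF D(1)])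
      have "q (y \<xi> - ?w) = 0"
      proof (rule bcontfun_eqI)
        fix z
        have "open {d}" if "d \<in> E" for d using that E_disj derived_UNIV[of d] by blast
        then have "(\<Sum>d\<in>U \<xi> \<inter> E. apply_bcontfun (clopen_indicator {d}) z)
          = (\<Sum>d\<in>U \<xi> \<inter> E. if z = d then 1 else 0)"
          by (intro sum.cong) (auto simp: clopen_indicator_apply indicator_def)
        moreover have "apply_bcontfun (\<Sum>d\<in>U \<xi> \<inter> E. clopen_indicator {d}) z
          = (\<Sum>d\<in>U \<xi> \<inter> E. apply_bcontfun (clopen_indicator {d}) z)"
          using sum_apply_bcontfun[of "\<lambda>_. 1" "\<lambda>d. clopen_indicator {d}" "U \<xi> \<inter> E" z] by simp
        moreover have "open (U \<xi>)" "closed (U \<xi>)" using U_open U_closed \<xi> F by auto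
        ultimately show "apply_bcontfun (q (y \<xi> - ?w)) z = apply_bcontfun 0 z"
          using V[OF \<xi>] E_fin
          by (simp add: y_def linear_diff[OF q] linear_sum[OF q] L clopen_indicator_apply V_def indicator_def)
      qed
      then have "(\<lambda>n. D n (y \<xi> - ?w)) \<longlonglongrightarrow> 0" by (rule ker)
      from tendsto_add[OF this 1] show ?thesis by (simp add: linear_diff[OF D(1)])
    qed
    have "(\<lambda>n. \<Sum>\<xi>\<in>F. \<bar>D n (y \<xi>)\<bar>) \<longlonglongrightarrow> (\<Sum>\<xi>\<in>F. 0)"
      by (intro tendsto_sum tendsto_rabs_zero y_null)
    then have "\<forall>\<^sub>F n in sequentially. (\<Sum>\<xi>\<in>F. \<bar>D n (y \<xi>)\<bar>) < 1" by (intro order_tendstoD(2)) auto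
    with V_bound show ?thesis
    proof eventually_elim
      case (elim n)
      have "(\<Sum>\<xi>\<in>F. \<bar>h \<xi> n\<bar>) \<le> (\<Sum>\<xi>\<in>F. \<bar>D n (L (clopen_indicator (V \<xi>)))\<bar> + \<bar>D n (y \<xi>)\<bar>)"
        by (rule sum_mono) (simp add: h_def y_def linear_diff[OF D(1)])
      then show ?case using elim by (simp add: sum.distrib)
    qed
  qed
  \<comment> \<open>The poset needs rational masses; an error tending to 0 is harmless.\<close>
  obtain \<rho> where \<rho>: "\<And>\<xi> n. \<bar>h \<xi> n - of_rat (\<rho> \<xi> n)\<bar> \<le> inverse (real (Suc n))"
    using rational_approximation by metis
  have \<rho>_null: "(\<lambda>n. h \<xi> n - of_rat (\<rho> \<xi> n)) \<longlonglongrightarrow> 0" for \<xi>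
    by (rule Lim_null_comparison[OF _ LIMSEQ_inverse_real_of_nat]) (use \<rho> in simp)
  obtain N :: nat where N: "B * M + 3 \<le> real N" using real_arch_simple by blast
  have \<rho>_bound: "\<forall>\<^sub>F n in sequentially. (\<Sum>\<xi>\<in>F. \<bar>\<rho> \<xi> n\<bar>) \<le> of_nat N" if F: "finite F" "F \<subseteq> S" for F
  proof -
    have "(\<lambda>n. \<Sum>\<xi>\<in>F. \<bar>h \<xi> n - of_rat (\<rho> \<xi> n)\<bar>) \<longlonglongrightarrow> (\<Sum>\<xi>\<in>F. 0)"
      by (intro tendsto_sum tendsto_rabs_zero \<rho>_null)
    then have "\<forall>\<^sub>F n in sequentially. (\<Sum>\<xi>\<in>F. \<bar>h \<xi> n - of_rat (\<rho> \<xi> n)\<bar>) < 1"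
      by (intro order_tendstoD(2)) auto
    with h_bound[OF F] show ?thesis
    proof eventually_elim
      case (elim n)
      have "real_of_rat (\<Sum>\<xi>\<in>F. \<bar>\<rho> \<xi> n\<bar>) = (\<Sum>\<xi>\<in>F. \<bar>of_rat (\<rho> \<xi> n)\<bar>)" by (simp add: of_rat_sum)
      also have "\<dots> \<le> (\<Sum>\<xi>\<in>F. \<bar>h \<xi> n\<bar> + \<bar>h \<xi> n - of_rat (\<rho> \<xi> n)\<bar>)" by (rule sum_mono) linarith
      also have "\<dots> \<le> real N" using elim N by (simp add: sum.distrib)
      finally have "real_of_rat (\<Sum>\<xi>\<in>F. \<bar>\<rho> \<xi> n\<bar>) \<le> real_of_rat (of_nat N)" by simp
      then show ?case by (simp only: of_rat_less_eq)
    qed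
  qed
  define A where "A \<xi> = {k. e k \<in> U \<xi>}" for \<xi>
  have A_inf: "infinite (A \<xi>)" if "\<xi> \<in> S" for \<xi>
  proof
    assume "finite (A \<xi>)"
    have "U \<xi> \<subseteq> e ` A \<xi> \<union> {\<xi>}"
    proof
      fix x assume x: "x \<in> U \<xi>"
      show "x \<in> e ` A \<xi> \<union> {\<xi>}"
      proof (cases "x \<in> derived UNIV")
        case True
        then show ?thesis using x U_K1[OF that] by auto
      next
        case False
        then obtain k where "x = e k" using e(2) by blast
        then show ?thesis using x by (auto simp: A_def)
      qed
    qed
    then have "finite (U \<xi>)" by (rule finite_subset) (simp add: \<open>finite (A \<xi>)\<close>)
    moreover have "\<xi> \<in> U \<xi> \<inter> derived UNIV" unfolding U_K1[OF that] by simp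
    then have "\<xi> islimpt UNIV" "\<xi> \<in> U \<xi>" "open (U \<xi>)" using U_open[OF that] by (auto simp: derived_def)
    ultimately show False unfolding islimpt_eq_acc_point by auto
  qed
  have A_ad: "finite (A \<xi> \<inter> A \<eta>)" if "\<xi> \<in> S" "\<eta> \<in> S" "\<xi> \<noteq> \<eta>" for \<xi> \<eta>
  proof -
    have "A \<xi> \<inter> A \<eta> = e -` (U \<xi> \<inter> U \<eta>)" by (auto simp: A_def)
    then show ?thesis using finite_vimageI[OF finInt[OF that] e(1)] by simp
  qed
  obtain \<mu> where \<mu>: "\<And>n. variation (\<mu> n) \<le> 2 * of_nat N"
    "\<And>k. \<forall>\<^sub>F n in sequentially. k \<notin> fst ` set (\<mu> n)"
    "\<And>\<xi>. \<xi> \<in> S \<Longrightarrow> \<forall>\<^sub>F n in sequentially. mass (\<mu> n) (A \<xi>) = \<rho> \<xi> n"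
    by (rule martins_axiom_masses[where S = S and A = A and h = \<rho> and C = "of_nat N",
      OF ma A_inf A_ad \<rho>_bound]) (assumption | rule that)+
  define pairing where "pairing l g = (\<Sum>(k, r)\<leftarrow>l. real_of_rat r * apply_bcontfun g (e k))"
    for l :: "(nat \<times> rat) list" and g :: "'k \<Rightarrow>\<^sub>C real"
  have pairing_linear: "linear (pairing l)" for l
    by (rule linearI; induction l) (auto simp: pairing_def algebra_simps)
  have pairing_bound: "\<bar>pairing l g\<bar> \<le> of_rat (variation l) * norm g" for l g
  proof (induction l)
    case (Cons p l)
    obtain k r where p: "p = (k, r)" by fastforce
    have "\<bar>real_of_rat r * apply_bcontfun g (e k)\<bar> \<le> of_rat \<bar>r\<bar> * norm g"
      using norm_bounded[of g "e k"] by (auto simp: abs_mult intro: mult_left_mono)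
    then show ?case using Cons by (auto simp: pairing_def variation_def p of_rat_add algebra_simps)
  qed (simp add: pairing_def variation_def)
  have pairing_ind: "pairing l (clopen_indicator W) = of_rat (mass l {k. e k \<in> W})"
    if "open W" "closed W" for l W
    using that by (induction l) (auto simp: pairing_def mass_def clopen_indicator_apply indicator_def of_rat_add)
  show ?thesis
  proof (rule that[of "\<lambda>n. pairing (\<mu> n)" "2 * real N"])
    show "\<bar>pairing (\<mu> n) g\<bar> \<le> 2 * real N * norm g" for n g
    proof -
      have "real_of_rat (variation (\<mu> n)) \<le> real_of_rat (2 * of_nat N)" using \<mu>(1)
        by (simp only: of_rat_less_eq)
      then have "real_of_rat (variation (\<mu> n)) \<le> 2 * real N" by (simp add: of_rat_mult)
      then show ?thesis using pairing_bound[of "\<mu> n" g] by (meson mult_right_mono norm_ge_zero order_trans)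
    qed
  next
    fix x k assume x: "q x = clopen_indicator {e k}"
    have "\<forall>\<^sub>F n in sequentially. D n x = D n x - pairing (\<mu> n) (q x)"
      using \<mu>(2)[of k]
    proof eventually_elim
      case (elim n)
      have "{j. e j \<in> {e k}} = {k}" using e(1) by (auto dest: injD)
      then have "pairing (\<mu> n) (q x) = of_rat (mass (\<mu> n) {k})" unfolding x
        by (subst pairing_ind) (auto simp: open_e)
      also have "mass (\<mu> n) {k} = 0"
        by (rule mass_disjoint) (use elim in auto)
      finally show ?case by simp
    qed
    with iso[OF x] show "(\<lambda>n. D n x - pairing (\<mu> n) (q x)) \<longlonglongrightarrow> 0" by (rule Lim_transform_eventually)
  next
    fix x \<xi> assume \<xi>: "\<xi> \<in> S" and x: "q x = clopen_indicator (U \<xi>)"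
    have "\<forall>\<^sub>F n in sequentially. D n (x - L (clopen_indicator (U \<xi>))) + (h \<xi> n - of_rat (\<rho> \<xi> n))
      = D n x - pairing (\<mu> n) (q x)"
      using \<mu>(3)[OF \<xi>]
    proof eventually_elim
      case (elim n)
      have "pairing (\<mu> n) (q x) = of_rat (mass (\<mu> n) (A \<xi>))" unfolding x using U_open[OF \<xi>] U_closed[OF \<xi>]
        by (simp add: pairing_ind A_def)
      then show ?case using elim by (simp add: h_def linear_diff[OF D(1)])
    qed
    moreover have "(\<lambda>n. D n (x - L (clopen_indicator (U \<xi>))) + (h \<xi> n - of_rat (\<rho> \<xi> n))) \<longlonglongrightarrow> 0 + 0"
      by (intro tendsto_add ker \<rho>_null) (simp add: linear_diff[OF q] L x)
    ultimately show "(\<lambda>n. D n x - pairing (\<mu> n) (q x)) \<longlonglongrightarrow> 0"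
      by (simp add: Lim_transform_eventually)
  qed (use pairing_linear in auto)
qed

text \<open>At finitely many points with a biorthogonal family \<open>\<phi>\<close>, the point masses can be weighted so
  that the corrected functionals vanish on one lift of each \<open>\<phi> p\<close>, and hence are null on every
  lift.\<close>

lemma finite_correction:
  fixes q :: "'x::real_normed_vector \<Rightarrow> ('k::topological_space \<Rightarrow>\<^sub>C real)" and D :: "nat \<Rightarrow> 'x \<Rightarrow> real"
  assumes D: "\<And>n. linear (D n)" "\<And>n x. \<bar>D n x\<bar> \<le> B * norm x"
    and q: "linear q" and ker: "\<And>x. q x = 0 \<Longrightarrow> (\<lambda>n. D n x) \<longlonglongrightarrow> 0" and surj: "surj q"
    and P: "finite P" and \<phi>: "\<And>p p'. p \<in> P \<Longrightarrow> p' \<in> P \<Longrightarrow> apply_bcontfun (\<phi> p) p' = (if p' = p then 1 else 0)"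
  obtains b :: "nat \<Rightarrow> ('k \<Rightarrow>\<^sub>C real) \<Rightarrow> real" and C
  where "\<And>n. linear (b n)" "\<And>n g. \<bar>b n g\<bar> \<le> C * norm g"
    "\<And>n g. \<forall>p\<in>P. apply_bcontfun g p = 0 \<Longrightarrow> b n g = 0"
    "\<And>x p. p \<in> P \<Longrightarrow> q x = \<phi> p \<Longrightarrow> (\<lambda>n. D n x - b n (q x)) \<longlonglongrightarrow> 0"
proof -
  define L where "L p = inv q (\<phi> p)" for p
  have L: "q (L p) = \<phi> p" for p using surj by (simp add: L_def surj_f_inv_f)
  define b where "b n g = (\<Sum>p\<in>P. D n (L p) * apply_bcontfun g p)" for n and g :: "'k \<Rightarrow>\<^sub>C real"
  show ?thesis
  proof (rule that[of b "\<Sum>p\<in>P. B * norm (L p)"])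
    show "linear (b n)" for n
      by (rule linearI) (simp_all add: b_def sum.distrib sum_distrib_left algebra_simps)
    show "\<bar>b n g\<bar> \<le> (\<Sum>p\<in>P. B * norm (L p)) * norm g" for n g
    proof -
      have "\<bar>b n g\<bar> \<le> (\<Sum>p\<in>P. B * norm (L p) * norm g)"
        unfolding b_def
      proof (intro order_trans[OF sum_abs] sum_mono)
        fix p
        have "0 \<le> B * norm (L p)" using D(2)[of 0 "L p"] by linarith
        then show "\<bar>D n (L p) * apply_bcontfun g p\<bar> \<le> B * norm (L p) * norm g"
          using D(2)[of n "L p"] norm_bounded[of g p] unfolding abs_mult by (intro mult_mono) auto
      qed
      then show ?thesis by (simp add: sum_distrib_right)
    qed
    show "b n g = 0" if "\<forall>p\<in>P. apply_bcontfun g p = 0" for n g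
      unfolding b_def using that by simp
    fix x p assume p: "p \<in> P" and x: "q x = \<phi> p"
    have "D n x - b n (q x) = D n (x - L p)" for n
    proof -
      have "b n (q x) = (\<Sum>p'\<in>P. if p' = p then D n (L p') else 0)"
        unfolding b_def x by (rule sum.cong) (use \<phi> p in auto)
      then show ?thesis using p P by (simp add: linear_diff[OF D(1)])
    qed
    then show "(\<lambda>n. D n x - b n (q x)) \<longlonglongrightarrow> 0"
      using ker[of "x - L p"] by (simp add: linear_diff[OF q] L x)
  qed
qed

text \<open>Choosing for each \<open>\<xi>\<close> a basic neighbourhood inside \<open>U \<xi>\<close> is injective.\<close>

lemma card_isolated_le_weight:
  fixes S :: "'k::topological_space set"
  assumes w: "has_weight TYPE('k) \<kappa>" and U: "\<And>\<xi>. \<xi> \<in> S \<Longrightarrow> open (U \<xi>) \<and> U \<xi> \<inter> S = {\<xi>}"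
  shows "|S| \<le>o \<kappa>"
proof -
  obtain \<B> :: "'k set set" where \<B>: "topological_basis \<B>" "( |\<B>|, \<kappa>) \<in> ordIso"
    using w by (auto simp: has_weight_def)
  have "\<exists>W\<in>\<B>. \<xi> \<in> W \<and> W \<subseteq> U \<xi>" if "\<xi> \<in> S" for \<xi>
  proof -
    have "open (U \<xi>)" "\<xi> \<in> U \<xi>" using U[OF that] by auto
    then obtain W where "W \<in> \<B>" "\<xi> \<in> W" "W \<subseteq> U \<xi>" by (rule topological_basisE[OF \<B>(1)])
    then show ?thesis by blast
  qed
  then obtain W where W: "\<And>\<xi>. \<xi> \<in> S \<Longrightarrow> W \<xi> \<in> \<B> \<and> \<xi> \<in> W \<xi> \<and> W \<xi> \<subseteq> U \<xi>" by metis
  have "inj_on W S"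
  proof (rule inj_onI)
    fix \<xi> \<eta> assume "\<xi> \<in> S" "\<eta> \<in> S" "W \<xi> = W \<eta>"
    then have "\<eta> \<in> U \<xi> \<inter> S" using W by blast
    then show "\<xi> = \<eta>" using U[OF \<open>\<xi> \<in> S\<close>] by simp
  qed
  then have "|S| \<le>o |\<B>|" using W card_of_ordLeq[of S \<B>] by blast
  then show ?thesis using \<B>(2) ordLeq_ordIso_trans by blast
qed

section \<open>Splitting of the twisted sum\<close>

theorem theorem9p7:
  fixes \<kappa> :: "'c rel"
    and i :: "c0 \<Rightarrow> 'x::banach"
    and q :: "'x \<Rightarrow> ('k::t2_space \<Rightarrow>\<^sub>C real)"
  assumes "Card_order \<kappa>"
    and "martins_axiom \<kappa>"
    and "compact (UNIV :: 'k set)"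
    and "separable_space (euclidean :: 'k topology)"
    and "scattered (UNIV :: 'k set)"
    and "has_cb_height (UNIV :: 'k set) 3"
    and "has_weight TYPE('k) \<kappa>"
    and "twisted_sum i q"
  shows "trivial_twisted_sum i q"
proof -
  note K = \<open>compact UNIV\<close>
  have i: "bounded_linear i" "inj i" and q: "bounded_linear q" "surj q" and exact: "range i = {x. q x = 0}"
    using \<open>twisted_sum i q\<close> by (auto simp: twisted_sum_def)
  interpret q: bounded_linear q by fact
  have qlin: "linear q" by (rule q.linear)
  \<comment> \<open>\<open>K1\<close> and \<open>K2\<close> are the first two derivatives; the points of \<open>S = K1 - K2\<close> are isolated in
    \<open>K1\<close>.\<close>
  define K1 where "K1 = derived (UNIV :: 'k set)"
  define K2 where "K2 = derived K1"
  have K3: "derived K2 = {}" and K2_ne: "K2 \<noteq> {}"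
    using has_cb_height_3_derived[OF \<open>has_cb_height UNIV 3\<close>] by (auto simp: K1_def K2_def)
  have K2_sub: "K2 \<subseteq> K1" unfolding K2_def K1_def by (rule derived_mono) simp
  have K2_fin: "finite K2"
  proof (rule compact_disjoint_derived_finite)
    have "closed K2" unfolding K2_def by (rule closed_derived)
    then show "compact K2" using compact_Int_closed[OF K] by (metis Int_UNIV_left)
  qed (simp add: K3)
  define S where "S = K1 - K2"
  have S_inf: "infinite S"
  proof
    assume "finite S"
    then have "finite K1" using K2_fin K2_sub by (simp add: S_def)
    then show False using K2_ne by (auto simp: K2_def derived_def islimpt_finite)
  qed
  have "\<exists>V. open V \<and> closed V \<and> V \<inter> K1 = {\<xi>}" if \<xi>: "\<xi> \<in> S" for \<xi>
  proof -
    have "\<xi> \<in> derived UNIV" "\<xi> \<notin> derived (derived UNIV)" using \<xi> by (simp_all add: S_def K1_def K2_def)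
    then obtain V where "open V" "closed V" "V \<inter> derived UNIV = {\<xi>}" by (rule isolating_clopen[OF K])
    then show ?thesis by (intro exI[of _ V]) (simp add: K1_def)
  qed
  then have "\<forall>\<xi>\<in>S. \<exists>V. open V \<and> closed V \<and> V \<inter> K1 = {\<xi>}" by simp
  from bchoice[OF this] obtain U
    where U: "\<And>\<xi>. \<xi> \<in> S \<Longrightarrow> open (U \<xi>) \<and> closed (U \<xi>) \<and> U \<xi> \<inter> K1 = {\<xi>}" by auto
  have U_open: "open (U \<xi>)" and U_closed: "closed (U \<xi>)" and U_K1: "U \<xi> \<inter> K1 = {\<xi>}"
    if "\<xi> \<in> S" for \<xi> using U[OF that] by auto
  have card: "|S| \<le>o \<kappa>"
  proof (rule card_isolated_le_weight[OF \<open>has_weight TYPE('k) \<kappa>\<close>, of _ U], intro conjI)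
    fix \<xi> assume \<xi>: "\<xi> \<in> S"
    show "open (U \<xi>)" by (rule U_open[OF \<xi>])
    have "U \<xi> \<inter> S = (U \<xi> \<inter> K1) \<inter> S" by (auto simp: S_def)
    then show "U \<xi> \<inter> S = {\<xi>}" unfolding U_K1[OF \<xi>] using \<xi> by simp
  qed
  have "infinite (- K1)"
  proof
    assume fin: "finite (- K1)"
    obtain \<xi> where \<xi>: "\<xi> \<in> S" using S_inf by fastforce
    have "U \<xi> \<subseteq> U \<xi> \<inter> K1 \<union> - K1" by blast
    then have "finite (U \<xi>)" unfolding U_K1[OF \<xi>] by (rule finite_subset) (simp add: fin)
    moreover have "\<xi> \<in> U \<xi> \<inter> K1" unfolding U_K1[OF \<xi>] by simp
    moreover have "\<xi> islimpt UNIV" using \<xi> by (auto simp: S_def K1_def derived_def)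
    ultimately show False using U_open[OF \<xi>] unfolding islimpt_eq_acc_point by auto
  qed
  then obtain e :: "nat \<Rightarrow> 'k" where "bij_betw e UNIV (- K1)"
    using countable_isolated_points[OF \<open>separable_space euclidean\<close>] bij_betw_from_nat_into by (metis K1_def)
  then have e: "inj e" "range e = - K1" by (auto simp: bij_betw_def)
  have open_e: "open {e k}" for k using e(2) derived_UNIV[of "e k"] by (auto simp: K1_def)
  have "\<exists>\<phi> :: 'k \<Rightarrow>\<^sub>C real. apply_bcontfun \<phi> p = 1 \<and> (\<forall>x\<in>K2 - {p}. apply_bcontfun \<phi> x = 0)" for p
    using urysohn_function[OF K, of "K2 - {p}" p] K2_fin by (metis Diff_iff finite_Diff singletonI)
  then obtain \<phi> :: "'k \<Rightarrow> 'k \<Rightarrow>\<^sub>C real"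
    where \<phi>': "\<And>p. apply_bcontfun (\<phi> p) p = 1 \<and> (\<forall>x\<in>K2 - {p}. apply_bcontfun (\<phi> p) x = 0)" by metis
  then have \<phi>: "apply_bcontfun (\<phi> p) x = (if x = p then 1 else 0)" if "x \<in> K2" for p x
    using that by auto

  have "closed (range i)"
    unfolding exact by (intro closed_Collect_eq continuous_intros q.continuous_on)
  obtain f B where B: "B > 0" and f: "\<And>n. linear (f n)" "\<And>n x. \<bar>f n x\<bar> \<le> B * norm x"
    and fi: "\<And>n z. f n (i z) = apply_bcontfun (c0_seq z) n"
    by (rule coordinate_extensions[OF i \<open>closed (range i)\<close>]) (assumption | rule that)+
  have "closed (range q)" using q(2) by simp
  obtain M where M: "M > 0" "\<And>y. \<exists>x. q x = y \<and> norm x \<le> M * norm y"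
    by (rule open_mapping[OF q(1) \<open>closed (range q)\<close>]) (assumption | rule that | simp add: q(2))+
  obtain Q where Q: "Q > 0" "\<And>x. norm (q x) \<le> norm x * Q" using q.pos_bounded by blast

  have f_ker: "(\<lambda>n. f n x) \<longlonglongrightarrow> 0" if "q x = 0" for x
  proof -
    obtain z where "x = i z" using exact \<open>q x = 0\<close> by blast
    then show ?thesis using c0_seq_tendsto[of z] by (simp add: fi)
  qed
  have corrected: "linear (\<lambda>x. D n x - a n (q x))" "\<bar>D n x - a n (q x)\<bar> \<le> (B' + \<bar>C\<bar> * Q) * norm x"
    if D: "\<And>n. linear (D n)" "\<And>n x. \<bar>D n x\<bar> \<le> B' * norm x"
      and a: "\<And>n. linear (a n)" "\<And>n g. \<bar>a n g\<bar> \<le> C * norm g"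
    for D :: "nat \<Rightarrow> 'x \<Rightarrow> real" and a :: "nat \<Rightarrow> ('k \<Rightarrow>\<^sub>C real) \<Rightarrow> real" and B' C n x
  proof -
    show "linear (\<lambda>x. D n x - a n (q x))"
      using linear_compose_sub[OF D(1) linear_compose[OF qlin a(1)]] by (simp add: o_def)
    have "\<bar>a n (q x)\<bar> \<le> \<bar>C\<bar> * norm (q x)"
      using a(2)[of n "q x"] mult_right_mono[OF abs_ge_self[of C] norm_ge_zero[of "q x"]] by linarith
    also have "\<dots> \<le> \<bar>C\<bar> * (norm x * Q)" by (intro mult_left_mono Q(2)) simp
    finally show "\<bar>D n x - a n (q x)\<bar> \<le> (B' + \<bar>C\<bar> * Q) * norm x"
      using D(2)[of n x] by (simp add: algebra_simps)
  qed

  obtain a Ca where a: "\<And>n. linear (a n)" "\<And>n g. \<bar>a n g\<bar> \<le> Ca * norm g"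
    and a_iso: "\<And>x k. q x = clopen_indicator {e k} \<Longrightarrow> (\<lambda>n. f n x - a n (q x)) \<longlonglongrightarrow> 0"
    by (rule isolated_point_correction[where q = q and D = f and e = e,
      OF qlin M f less_imp_le[OF B] f_ker e(1) open_e]) (assumption | rule that)+
  define f1 where "f1 n x = f n x - a n (q x)" for n x
  have f1: "\<And>n. linear (f1 n)" "\<And>n x. \<bar>f1 n x\<bar> \<le> (B + \<bar>Ca\<bar> * Q) * norm x"
    using corrected[where D = f and a = a, OF f a] unfolding f1_def by blast+
  have f1_ker: "(\<lambda>n. f1 n x) \<longlonglongrightarrow> 0" if "q x = 0" for x
    using f_ker[OF that] that by (simp add: f1_def linear_0[OF a(1)])
  have B1: "B + \<bar>Ca\<bar> * Q \<ge> 0" using B Q(1) by simp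
  obtain c Cc where c: "\<And>n. linear (c n)" "\<And>n g. \<bar>c n g\<bar> \<le> Cc * norm g"
    and c_iso: "\<And>x k. q x = clopen_indicator {e k} \<Longrightarrow> (\<lambda>n. f1 n x - c n (q x)) \<longlonglongrightarrow> 0"
    and c_U: "\<And>x \<xi>. \<xi> \<in> S \<Longrightarrow> q x = clopen_indicator (U \<xi>) \<Longrightarrow> (\<lambda>n. f1 n x - c n (q x)) \<longlonglongrightarrow> 0"
    by (rule martin_correction[where S = S and U = U and q = q and D = f1 and e = e,
      OF \<open>martins_axiom \<kappa>\<close> \<open>Card_order \<kappa>\<close> card S_inf K U[unfolded K1_def] qlin M f1 B1 f1_ker
        e[unfolded K1_def] a_iso[folded f1_def]]) (assumption | rule that)+
  define f2 where "f2 n x = f1 n x - c n (q x)" for n x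
  have f2: "\<And>n. linear (f2 n)" "\<And>n x. \<bar>f2 n x\<bar> \<le> (B + \<bar>Ca\<bar> * Q + \<bar>Cc\<bar> * Q) * norm x"
    using corrected[where D = f1 and a = c, OF f1 c] unfolding f2_def by blast+
  have f2_ker: "(\<lambda>n. f2 n x) \<longlonglongrightarrow> 0" if "q x = 0" for x
    using f1_ker[OF that] that by (simp add: f2_def linear_0[OF c(1)])
  obtain b Cb where b: "\<And>n. linear (b n)" "\<And>n g. \<bar>b n g\<bar> \<le> Cb * norm g"
    and b_0: "\<And>n g. \<forall>p\<in>K2. apply_bcontfun g p = 0 \<Longrightarrow> b n g = 0"
    and b_\<phi>: "\<And>x p. p \<in> K2 \<Longrightarrow> q x = \<phi> p \<Longrightarrow> (\<lambda>n. f2 n x - b n (q x)) \<longlonglongrightarrow> 0"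
    by (rule finite_correction[where D = f2 and q = q and P = K2 and \<phi> = \<phi>,
      OF f2 qlin f2_ker q(2) K2_fin \<phi>]) (assumption | rule that)+
  define D where "D n x = f2 n x - b n (q x)" for n x
  have D: "\<And>n. linear (D n)" "\<And>n x. \<bar>D n x\<bar> \<le> (B + \<bar>Ca\<bar> * Q + \<bar>Cc\<bar> * Q + \<bar>Cb\<bar> * Q) * norm x"
    using corrected[where D = f2 and a = b, OF f2 b] unfolding D_def by blast+
  have D_ker: "(\<lambda>n. D n x) \<longlonglongrightarrow> 0" if "q x = 0" for x
    using f2_ker[OF that] that by (simp add: D_def linear_0[OF b(1)])

  \<comment> \<open>Each generator was handled by one correction and is not affected by the later ones: measures
    \<open>c n\<close> eventually miss every isolated point, and \<open>b n\<close> lives on \<open>K2\<close>, where the indicators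
    vanish.\<close>
  define gens where "gens = (\<lambda>d. clopen_indicator {d}) ` (- K1) \<union> (\<lambda>\<xi>. clopen_indicator (U \<xi>)) ` (K1 - K2)
    \<union> \<phi> ` K2"
  have "(\<lambda>n. D n x) \<longlonglongrightarrow> 0" if x: "q x \<in> gens" for x
  proof -
    from x consider d where "d \<in> - K1" "q x = clopen_indicator {d}"
      | \<xi> where "\<xi> \<in> S" "q x = clopen_indicator (U \<xi>)"
      | p where "p \<in> K2" "q x = \<phi> p" unfolding gens_def S_def by blast
    then show ?thesis
    proof cases
      case 1
      then obtain k where k: "d = e k" using e(2) by blast
      have "apply_bcontfun (q x) p = 0" if "p \<in> K2" for p
        using that K2_sub 1 open_e[of k] by (auto simp: k clopen_indicator_apply indicator_def)
      then have "b n (q x) = 0" for n by (intro b_0) simp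
      then show ?thesis using c_iso[of x k] 1 by (simp add: D_def f2_def k)
    next
      case 2
      have "apply_bcontfun (q x) p = 0" if "p \<in> K2" for p
      proof -
        have "p \<notin> U \<xi> \<inter> K1" unfolding U_K1[OF 2(1)] using 2(1) that by (auto simp: S_def)
        then have "p \<notin> U \<xi>" using that K2_sub by blast
        then show ?thesis using U_open[OF 2(1)] U_closed[OF 2(1)] 2(2) by (simp add: clopen_indicator_apply)
      qed
      then have "b n (q x) = 0" for n by (intro b_0) simp
      then show ?thesis using c_U[OF 2] by (simp add: D_def f2_def)
    next
      case 3
      then show ?thesis using b_\<phi> by (simp add: D_def)
    qed
  qed
  moreover have "q ` {x. q x \<in> gens} = gens" using q(2) by (auto simp: image_iff)
  moreover have "closure (span gens) = UNIV"
    unfolding gens_def K1_def K2_def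
    by (rule dense_span_generators[OF K]) (use K2_fin \<phi> U in \<open>auto simp: K1_def K2_def S_def\<close>)
  ultimately have "(\<lambda>n. D n x) \<longlonglongrightarrow> 0" for x
    using null_everywhere[OF qlin M D D_ker, of "{x. q x \<in> gens}"] by simp
  moreover have "D n (i z) = apply_bcontfun (c0_seq z) n" for n z
  proof -
    have "q (i z) = 0" using exact by blast
    then show ?thesis by (simp add: D_def f2_def f1_def fi linear_0[OF a(1)] linear_0[OF b(1)] linear_0[OF c(1)])
  qed
  ultimately show ?thesis
    using trivial_twisted_sumI[where D = D, OF \<open>twisted_sum i q\<close> D] by simp
qed

end
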